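(* Let $\ell\ge 2$ be an integer and let $p_1,\dots,p_k$ be its distinct prime factors. Let $n\ge 3$. Then $$\Delta(\operatorname{SL}(n,\mathbb{Z}/\ell))\le 12k(n-1),$$ and if $S$ is the conjugacy class of a matrix $A\in\operatorname{SL}(n,\mathbb{Z}/\ell)$ whose reduction modulo $p_i$ is not a scalar matrix in $\operatorname{SL}(n,\mathbb{Z}/p_i)$ for all $i=1,\dots,k$, then $$\log|S|\ge\frac{\log|\operatorname{SL}(n,\mathbb{Z}/\ell)|}{12k(n-1)}-2 .$$
   Context: $\log$ denotes $\log_2$. The hypothesis on $A$ is that for every $i$ the reduction of $A$ mod $p_i$ is non-scalar. A subset $S$ of a group $G$ normally generates $G$ if the normal subgroup of $G$ generated by $S$ is $G$. For such $S$, $\|g\|_S$ is the least $m\ge 0$ such that $g$ is a product of $m$ conjugates in $G$ of elements of $S$ and their inverses, and $\|G\|_S=\sup_{g\in G}\|g\|_S$. $\Delta(G)=\sup\{\|G\|_S : S \text{ finite, normally generates } G\}$. *)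

theory Defs
  imports
    Complex_Main
    "HOL-Library.Extended_Nat"
    "HOL-Algebra.Coset"
    "HOL-Number_Theory.Residues"
    "Jordan_Normal_Form.Determinant"
begin

section \<open>Conjugation-invariant word norms\<close>

definition conjugacy_class :: "('a, 'b) monoid_scheme \<Rightarrow> 'a \<Rightarrow> 'a set" where
  "conjugacy_class G a = {g \<otimes>\<^bsub>G\<^esub> a \<otimes>\<^bsub>G\<^esub> inv\<^bsub>G\<^esub> g | g. g \<in> carrier G}"

definition normal_closure :: "('a, 'b) monoid_scheme \<Rightarrow> 'a set \<Rightarrow> 'a set" where
  "normal_closure G S = \<Inter> {N. N \<lhd> G \<and> S \<subseteq> N}"

definition normally_generates :: "('a, 'b) monoid_scheme \<Rightarrow> 'a set \<Rightarrow> bool" where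
  "normally_generates G S \<longleftrightarrow> S \<subseteq> carrier G \<and> normal_closure G S = carrier G"

definition conjugates :: "('a, 'b) monoid_scheme \<Rightarrow> 'a set \<Rightarrow> 'a set" where
  "conjugates G S = (\<Union>s\<in>S. conjugacy_class G s \<union> conjugacy_class G (inv\<^bsub>G\<^esub> s))"

text \<open>The value is \<open>\<infinity>\<close> if \<open>g\<close> is not a product of conjugates of elements
  of \<open>S\<close> and their inverses; \<open>length xs\<close> is the number of factors.\<close>

definition word_norm :: "('a, 'b) monoid_scheme \<Rightarrow> 'a set \<Rightarrow> 'a \<Rightarrow> enat" where
  "word_norm G S g =
     Inf {enat (length xs) | xs. set xs \<subseteq> conjugates G S \<and> foldr (\<otimes>\<^bsub>G\<^esub>) xs \<one>\<^bsub>G\<^esub> = g}"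

definition group_norm :: "('a, 'b) monoid_scheme \<Rightarrow> 'a set \<Rightarrow> enat" where
  "group_norm G S = (SUP g\<in>carrier G. word_norm G S g)"

definition Delta :: "('a, 'b) monoid_scheme \<Rightarrow> enat" where
  "Delta G = (SUP S\<in>{S. finite S \<and> normally_generates G S}. group_norm G S)"


section \<open>The special linear group over \<open>\<int>/m\<close>\<close>

text \<open>As in the library's \<open>residue_ring m\<close>, an element of \<open>\<int>/m\<close> is represented
  by the integer \<open>0 \<le> x < m\<close> in its class. Products and determinants over
  \<open>\<int>/m\<close> are those of the integer representatives, reduced modulo \<open>m\<close>.\<close>

definition reduce_mat :: "int \<Rightarrow> int mat \<Rightarrow> int mat" where
  "reduce_mat m A = map_mat (\<lambda>x. x mod m) A"

definition SL :: "nat \<Rightarrow> int \<Rightarrow> int mat monoid" where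
  "SL n m =
     \<lparr>carrier = {A \<in> carrier_mat n n.
                  elements_mat A \<subseteq> carrier (residue_ring m) \<and> [det A = 1] (mod m)},
      monoid.mult = (\<lambda>A B. reduce_mat m (A * B)),
      one = 1\<^sub>m n\<rparr>"

definition scalar_mat :: "nat \<Rightarrow> int \<Rightarrow> int mat \<Rightarrow> bool" where
  "scalar_mat n m A \<longleftrightarrow> (\<exists>c\<in>carrier (residue_ring m). A = c \<cdot>\<^sub>m 1\<^sub>m n)"


lemma reduce_mat_carrier [simp]: "reduce_mat m A \<in> carrier_mat nr nc \<longleftrightarrow> A \<in> carrier_mat nr nc"
  by (auto simp: reduce_mat_def)

lemma det_reduce_mat: "[det (reduce_mat m A) = det A] (mod m)"
proof (cases "dim_row A = dim_col A")
  case True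
  then have "[(\<Prod>i = 0..<dim_row A. reduce_mat m A $$ (i, p i)) =
      (\<Prod>i = 0..<dim_row A. A $$ (i, p i))] (mod m)" if "p permutes {0..<dim_row A}" for p
    using permutes_in_image[OF that]
    by (intro cong_prod) (auto simp: reduce_mat_def cong_def)
  with True show ?thesis
    unfolding Determinant.det_def
    by (auto simp: reduce_mat_def intro!: cong_sum cong_mult)
qed (simp add: Determinant.det_def reduce_mat_def)

lemma reduce_mat_mult_left:
  assumes "A \<in> carrier_mat n n" "B \<in> carrier_mat n n"
  shows "reduce_mat m (reduce_mat m A * B) = reduce_mat m (A * B)"
  using assms
  by (intro eq_matI)
     (auto simp: reduce_mat_def scalar_prod_def mod_mult_left_eq
           intro!: cong_sum[unfolded cong_def])

lemma reduce_mat_mult_right: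
  assumes "A \<in> carrier_mat n n" "B \<in> carrier_mat n n"
  shows "reduce_mat m (A * reduce_mat m B) = reduce_mat m (A * B)"
  using assms
  by (intro eq_matI)
     (auto simp: reduce_mat_def scalar_prod_def mod_mult_right_eq
           intro!: cong_sum[unfolded cong_def])

lemma reduce_mat_elements:
  assumes "m \<ge> 2"
  shows "elements_mat (reduce_mat m A) \<subseteq> carrier (residue_ring m)"
  using assms by (auto simp: reduce_mat_def residue_ring_def)

lemma reduce_mat_id:
  assumes "elements_mat A \<subseteq> carrier (residue_ring m)"
  shows "reduce_mat m A = A"
proof (intro eq_matI)
  fix i j assume ij: "i < dim_row A" "j < dim_col A"
  then have "A $$ (i, j) \<in> elements_mat A" by auto
  with assms ij show "reduce_mat m A $$ (i, j) = A $$ (i, j)"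
    by (auto simp: reduce_mat_def residue_ring_def)
qed (auto simp: reduce_mat_def)

lemma group_SL:
  assumes m: "m \<ge> 2"
  shows "group (SL n m)"
proof (rule groupI)
  fix A B assume "A \<in> carrier (SL n m)" "B \<in> carrier (SL n m)"
  then have "A \<in> carrier_mat n n" "B \<in> carrier_mat n n"
    "[det A = 1] (mod m)" "[det B = 1] (mod m)" by (auto simp: SL_def)
  then show "A \<otimes>\<^bsub>SL n m\<^esub> B \<in> carrier (SL n m)"
    using reduce_mat_elements[OF m] det_reduce_mat[of m "A * B"]
      cong_mult[of "det A" 1 m "det B" 1]
    by (auto simp: SL_def det_mult intro: cong_trans)
next
  have "elements_mat (1\<^sub>m n :: int mat) \<subseteq> carrier (residue_ring m)"
    using m by (auto simp: residue_ring_def elements_mat_def)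
  then show "\<one>\<^bsub>SL n m\<^esub> \<in> carrier (SL n m)" by (simp add: SL_def)
next
  fix A B C
  assume "A \<in> carrier (SL n m)" "B \<in> carrier (SL n m)" "C \<in> carrier (SL n m)"
  then have c: "A \<in> carrier_mat n n" "B \<in> carrier_mat n n" "C \<in> carrier_mat n n"
    by (auto simp: SL_def)
  have "reduce_mat m (reduce_mat m (A * B) * C) = reduce_mat m (A * B * C)"
    using c by (intro reduce_mat_mult_left[of _ n]) auto
  also have "A * B * C = A * (B * C)" using c by (rule assoc_mult_mat)
  also have "reduce_mat m (A * (B * C)) = reduce_mat m (A * reduce_mat m (B * C))"
    using c by (intro reduce_mat_mult_right[of _ n, symmetric]) auto
  finally show "A \<otimes>\<^bsub>SL n m\<^esub> B \<otimes>\<^bsub>SL n m\<^esub> C = A \<otimes>\<^bsub>SL n m\<^esub> (B \<otimes>\<^bsub>SL n m\<^esub> C)"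
    by (simp add: SL_def)
next
  fix A assume "A \<in> carrier (SL n m)"
  then show "\<one>\<^bsub>SL n m\<^esub> \<otimes>\<^bsub>SL n m\<^esub> A = A" by (auto simp: SL_def reduce_mat_id)
next
  fix A assume "A \<in> carrier (SL n m)"
  then have A: "A \<in> carrier_mat n n" and d: "[det A = 1] (mod m)" by (auto simp: SL_def)
  let ?B = "reduce_mat m (adj_mat A)"
  have adj: "adj_mat A \<in> carrier_mat n n" using A by (rule adj_mat)
  have "reduce_mat m (?B * A) = reduce_mat m (adj_mat A * A)"
    using adj A by (rule reduce_mat_mult_left)
  also have "\<dots> = reduce_mat m (det A \<cdot>\<^sub>m 1\<^sub>m n)" using adj_mat(3)[OF A] by simp
  also have "\<dots> = 1\<^sub>m n"
    using d m by (intro eq_matI) (auto simp: reduce_mat_def cong_def)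
  finally have inv: "reduce_mat m (?B * A) = 1\<^sub>m n" .
  have "det (adj_mat A) * det A = det A ^ n"
    using det_mult[OF adj A] adj_mat(3)[OF A] by simp
  moreover have "[det A ^ n = 1] (mod m)" using cong_pow[OF d, of n] by simp
  moreover have "[det (adj_mat A) * det A = det (adj_mat A)] (mod m)"
    using cong_mult[OF cong_refl d, of "det (adj_mat A)"] by simp
  ultimately have "[det (adj_mat A) = 1] (mod m)"
    by (metis cong_sym cong_trans)
  then have "?B \<in> carrier (SL n m)"
    using adj reduce_mat_elements[OF m] det_reduce_mat[of m "adj_mat A"]
    by (auto simp: SL_def intro: cong_trans)
  with inv show "\<exists>B\<in>carrier (SL n m). B \<otimes>\<^bsub>SL n m\<^esub> A = \<one>\<^bsub>SL n m\<^esub>"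
    by (intro bexI[of _ ?B]) (simp_all add: SL_def)
qed

lemma finite_SL: "finite (carrier (SL n m))"
proof -
  have "carrier (SL n m) \<subseteq>
      (\<lambda>f. mat n n f) ` (({0..<n} \<times> {0..<n}) \<rightarrow>\<^sub>E {0..<m})"
  proof
    fix A assume "A \<in> carrier (SL n m)"
    then have A: "A \<in> carrier_mat n n"
      and e: "\<And>i j. i < n \<Longrightarrow> j < n \<Longrightarrow> A $$ (i, j) \<in> {0..<m}"
      by (fastforce simp: SL_def residue_ring_def)+
    let ?f = "restrict (\<lambda>ij. A $$ ij) ({0..<n} \<times> {0..<n})"
    have "A = mat n n ?f" using A by (intro eq_matI) auto
    moreover have "?f \<in> ({0..<n} \<times> {0..<n}) \<rightarrow>\<^sub>E {0..<m}"
      using e by (auto simp: PiE_iff)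
    ultimately show "A \<in> (\<lambda>f. mat n n f) ` (({0..<n} \<times> {0..<n}) \<rightarrow>\<^sub>E {0..<m})"
      by blast
  qed
  then show ?thesis by (rule finite_subset) (intro finite_imageI finite_PiE; simp)
qed

end

theory Submission
  imports Defs
begin

text \<open>
  If \<open>A \<in> S\<close> is not scalar modulo the prime \<open>p\<close>, a conjugate of \<open>A\<close> has an off-diagonal entry that is
  a unit at \<open>p\<close>, and a double commutator \<open>[[A, T], F]\<close> with transvections \<open>T\<close>, \<open>F\<close>, which is a
  product of four conjugates of \<open>A\<close> and its inverse, is conjugate to any prescribed elementary
  matrix of the local factor of \<open>\<int>/l\<close> at \<open>p\<close>. In a local factor, adding arbitrary multiples of one
  row (or column) to the others is conjugate to an elementary matrix. Multiplying over the \<open>k\<close> primes,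
  every such operation over \<open>\<int>/l\<close> is a product of \<open>4k\<close> conjugates. Three operations per
  dimension reduce any matrix to the identity: one to create a unit below the diagonal, one to clear
  a column and one to clear a row; making the diagonal entry \<open>1\<close> in between is a conjugation, which is
  free. This gives \<open>3(n - 1) \<cdot> 4k\<close>. The bound on \<open>card S\<close> follows by counting words of that length in
  \<open>S \<union> S\<inverse>\<close>.
\<close>

section \<open>Arithmetic modulo \<open>l\<close>\<close>

text \<open>Stable range one for \<open>\<int>/l\<close>. With \<open>t\<close> the product of the
  primes of \<open>l\<close> that do not divide \<open>a\<close>, each prime of \<open>l\<close>
  divides exactly one of \<open>a\<close> and \<open>t * b\<close>: where it divides
  \<open>a\<close>, the relation \<open>bez\<close> keeps it from dividing \<open>b\<close>.\<close>

lemma exists_coprime_add_mult: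
  fixes a b c l :: int
  assumes "l \<noteq> 0" and bez: "[c * a + b = 1] (mod l)"
  shows "\<exists>t. coprime (a + t * b) l"
proof -
  define t where "t = \<Prod>{q \<in> prime_factors l. \<not> q dvd a}"
  have "\<not> p dvd a + t * b" if p: "prime p" "p dvd l" for p
  proof (cases "p dvd a")
    case True
    have "\<not> p dvd t"
    proof
      assume "p dvd t"
      then obtain q where q: "q \<in> prime_factors l" "\<not> q dvd a" "p dvd q"
        using p(1) unfolding t_def by (subst (asm) prime_dvd_prod_iff) auto
      then have "p = q" using p(1) by (auto intro: primes_dvd_imp_eq)
      with True q show False by simp
    qed
    moreover have "\<not> p dvd b"
    proof
      assume "p dvd b"
      with True have "p dvd c * a + b" by simp
      moreover have "[c * a + b = 1] (mod p)" using bez p(2) by (rule cong_dvd_modulus)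
      ultimately show False using p(1) by (metis cong_dvd_iff not_prime_unit)
    qed
    ultimately show ?thesis using True p(1) by (simp add: dvd_add_right_iff prime_dvd_mult_iff)
  next
    case False
    with p assms have "p \<in> {q \<in> prime_factors l. \<not> q dvd a}"
      by (auto simp: prime_factors_dvd)
    then have "p dvd t" unfolding t_def by (intro dvd_prodI) auto
    with False show ?thesis by (simp add: dvd_add_left_iff)
  qed
  then have "coprime (a + t * b) l"
    using \<open>l \<noteq> 0\<close> by (intro coprimeI) (metis dvd_0_left dvd_trans prime_divisor_exists)
  then show ?thesis by blast
qed

text \<open>\<open>E p\<close> is the idempotent of the local factor of \<open>\<int>/l\<close> at \<open>p\<close>.\<close>

lemma local_idempotents:
  fixes l :: int
  assumes "l > 0"
  obtains E where
    "[(\<Sum>p\<in>prime_factors l. E p) = 1] (mod l)"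
    "\<And>p c. p \<in> prime_factors l \<Longrightarrow> \<not> p dvd c \<Longrightarrow> \<exists>c'. [E p * (c * c') = E p] (mod l)"
proof -
  define P where "P = prime_factors l"
  define q where "q = (\<lambda>p. p ^ multiplicity p l)"
  define L where "L = (\<lambda>p. \<Prod>p'\<in>P - {p}. q p')"
  have fin: "finite P" by (simp add: P_def)
  have l: "l = (\<Prod>p\<in>P. q p)"
    using prod_prime_factors[of l] assms by (simp add: P_def q_def)
  have lq: "l = q p * L p" if "p \<in> P" for p
    unfolding l L_def by (rule prod.remove[OF fin that])
  have cop: "coprime (q p) (q p')" if "p \<in> P" "p' \<in> P" "p \<noteq> p'" for p p'
    using that by (auto simp: P_def q_def intro!: primes_coprime)
  have "coprime (L p) (q p)" if "p \<in> P" for p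
    unfolding L_def using that by (intro prod_coprime_left) (auto intro: cop)
  then have "\<forall>p\<in>P. \<exists>x. [L p * x = 1] (mod q p)"
    using cong_solve_coprime_int by blast
  then obtain x where x: "\<And>p. p \<in> P \<Longrightarrow> [L p * x p = 1] (mod q p)"
    by metis
  \<comment> \<open>Chinese remainder theorem: \<open>?E p\<close> is 1 modulo \<open>q p\<close>
    and 0 modulo every other \<open>q p'\<close>, because \<open>L p\<close> contains all the other
    prime powers.\<close>
  let ?E = "\<lambda>p. L p * x p"
  have "[(\<Sum>p\<in>P. ?E p) = 1] (mod q p)" if p: "p \<in> P" for p
  proof -
    have "[?E p' = 0] (mod q p)" if "p' \<in> P - {p}" for p'
    proof -
      have "q p dvd L p'" unfolding L_def using fin p that by (intro dvd_prodI) auto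
      then show ?thesis by (simp add: cong_0_iff)
    qed
    then have "[(\<Sum>p'\<in>P - {p}. ?E p') = (\<Sum>p'\<in>P - {p}. 0)] (mod q p)"
      by (rule cong_sum)
    with x[OF p] have "[?E p + (\<Sum>p'\<in>P - {p}. ?E p') = 1 + 0] (mod q p)"
      by (intro cong_add) auto
    then show ?thesis using sum.remove[OF fin p, of ?E] by simp
  qed
  then have 1: "[(\<Sum>p\<in>P. ?E p) = 1] (mod l)"
    unfolding l by (intro cong_cong_prod_coprime) (auto intro: cop)
  have 2: "\<exists>c'. [?E p * (c * c') = ?E p] (mod l)" if p: "p \<in> P" and c: "\<not> p dvd c" for p c
  proof -
    have "coprime p c" using p c by (intro prime_imp_coprime) (auto simp: P_def)
    then have "coprime c (q p)" unfolding q_def by (simp add: coprime_commute)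
    then obtain c' where "[c * c' = 1] (mod q p)" using cong_solve_coprime_int by blast
    then have "q p dvd c * c' - 1" by (simp add: cong_iff_dvd_diff)
    \<comment> \<open>Multiplying by \<open>L p\<close> lifts a congruence modulo \<open>q p\<close>
      to one modulo \<open>l = q p * L p\<close>.\<close>
    then have "q p * L p dvd (c * c' - 1) * L p" by (rule mult_dvd_mono) simp
    then have "l dvd x p * ((c * c' - 1) * L p)" using lq[OF p] by simp
    also have "\<dots> = ?E p * (c * c') - ?E p" by (simp add: algebra_simps)
    finally show ?thesis by (auto simp: cong_iff_dvd_diff)
  qed
  show thesis using that[of ?E] 1 2 by (simp add: P_def)
qed

text \<open>The ideals of a local factor of \<open>\<int>/l\<close> form a chain.\<close>

lemma local_dvd_total:
  fixes e p l :: int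
  assumes p: "prime p"
    and unit: "\<And>c. \<not> p dvd c \<Longrightarrow> \<exists>c'. [e * (c * c') = e] (mod l)"
  shows "(\<exists>z. [e * y = e * (x * z)] (mod l)) \<or> (\<exists>z. [e * x = e * (y * z)] (mod l))"
proof -
  have *: "\<exists>z. [e * y = e * (x * z)] (mod l)"
    if x: "x \<noteq> 0" and y: "y \<noteq> 0" and le: "multiplicity p x \<le> multiplicity p y" for x y
  proof -
    have np: "\<not> is_unit p" using p by auto
    obtain x' where x': "x = p ^ multiplicity p x * x'" "\<not> p dvd x'"
      by (rule multiplicity_decompose'[OF x np])
    obtain y' where y': "y = p ^ multiplicity p y * y'"
      by (rule multiplicity_decompose'[OF y np])
    obtain c' where c': "[e * (x' * c') = e] (mod l)" using unit[OF x'(2)] by blast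
    \<comment> \<open>The quotient of \<open>y\<close> by \<open>x\<close> is assembled from the
      quotient \<open>d\<close> of the \<open>p\<close>-parts and the local inverse
      \<open>c'\<close> of the part of \<open>x\<close> prime to \<open>p\<close>.\<close>
    define d where "d = p ^ (multiplicity p y - multiplicity p x)"
    have pd: "p ^ multiplicity p y = p ^ multiplicity p x * d"
      using le by (simp add: d_def flip: power_add)
    let ?w = "p ^ multiplicity p x * d * y'"
    have "[e * (x' * c') * ?w = e * ?w] (mod l)" using c' by (rule cong_mult) simp
    moreover have "e * ?w = e * y" by (subst y') (simp add: pd)
    moreover have "e * (x' * c') * ?w = e * (x * (c' * d * y'))"
      by (subst x') (simp add: algebra_simps)
    ultimately have "[e * y = e * (x * (c' * d * y'))] (mod l)" by (simp add: cong_sym_eq)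
    then show ?thesis by blast
  qed
  show ?thesis
  proof (cases "x = 0 \<or> y = 0")
    case True
    then show ?thesis by (metis cong_refl mult_zero_right)
  next
    case False
    then show ?thesis using *[of x y] *[of y x] by (metis nat_le_linear)
  qed
qed

lemma finite_total_dominating:
  assumes "finite J" "J \<noteq> {}"
    and total: "\<And>x y. R x y \<or> R y x" and trans: "\<And>x y z. R x y \<Longrightarrow> R y z \<Longrightarrow> R x z"
  shows "\<exists>i\<in>J. \<forall>j\<in>J. R i j"
  using assms(1,2)
proof (induction rule: finite_ne_induct)
  case (singleton x)
  then show ?case using total by blast
next
  case (insert x F)
  then show ?case using total trans by (metis insert_iff)
qed

text \<open>Local divisibility is a total preorder, so some entry of \<open>v\<close> divides all
  the others. That entry is the pivot from which a whole row or column is later generated.\<close>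

lemma local_dvd_minimum:
  fixes e p l :: int and v :: "'a \<Rightarrow> int"
  assumes p: "prime p"
    and unit: "\<And>c. \<not> p dvd c \<Longrightarrow> \<exists>c'. [e * (c * c') = e] (mod l)"
    and J: "finite J" "J \<noteq> {}"
  shows "\<exists>i\<in>J. \<forall>j\<in>J. \<exists>z. [e * v j = e * (v i * z)] (mod l)"
proof (rule finite_total_dominating[OF J])
  fix x y z
  assume "\<exists>a. [e * v y = e * (v x * a)] (mod l)" "\<exists>a. [e * v z = e * (v y * a)] (mod l)"
  then obtain a b where a: "[e * v y = e * (v x * a)] (mod l)"
    and b: "[e * v z = e * (v y * b)] (mod l)" by blast
  have "[e * v y * b = e * (v x * a) * b] (mod l)" using a by (rule cong_mult) simp
  with b have "[e * v z = e * (v x * (a * b))] (mod l)"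
    by (simp add: mult.assoc cong_trans)
  then show "\<exists>a. [e * v z = e * (v x * a)] (mod l)" by blast
qed (rule local_dvd_total[OF p unit])


section \<open>Products of conjugates\<close>

text \<open>Products of exactly \<open>m\<close> letters: lengths then add under multiplication, and
  the same sets serve both the norm bound and the counting bound.\<close>

primrec words :: "('a, 'b) monoid_scheme \<Rightarrow> 'a set \<Rightarrow> nat \<Rightarrow> 'a set" where
  "words G S 0 = {\<one>\<^bsub>G\<^esub>}"
| "words G S (Suc m) = conjugates G S <#>\<^bsub>G\<^esub> words G S m"

lemma words_foldr:
  "g \<in> words G S m \<Longrightarrow>
    \<exists>xs. length xs = m \<and> set xs \<subseteq> conjugates G S \<and> foldr (\<otimes>\<^bsub>G\<^esub>) xs \<one>\<^bsub>G\<^esub> = g"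
proof (induction m arbitrary: g)
  case (Suc m)
  then obtain c h where "c \<in> conjugates G S" "h \<in> words G S m" "g = c \<otimes>\<^bsub>G\<^esub> h"
    by (auto simp: set_mult_def)
  with Suc.IH[of h] show ?case by (metis foldr.simps(2) insert_subset length_Cons list.simps(15) o_apply)
qed simp

lemma word_norm_le:
  assumes "g \<in> words G S m"
  shows "word_norm G S g \<le> enat m"
  using words_foldr[OF assms] unfolding word_norm_def by (intro Inf_lower) auto

text \<open>A product is determined by its letters; this count yields the lower bound on the class
  size.\<close>

lemma card_words_le:
  assumes "finite (conjugates G S)"
  shows "finite (words G S m) \<and> card (words G S m) \<le> card (conjugates G S) ^ m"
proof (induction m)
  case (Suc m)
  have eq: "words G S (Suc m) =
      (\<lambda>(c, g). c \<otimes>\<^bsub>G\<^esub> g) ` (conjugates G S \<times> words G S m)"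
    by (auto simp: set_mult_def)
  have fin: "finite (conjugates G S \<times> words G S m)" using assms Suc.IH by simp
  have "card (words G S (Suc m)) \<le> card (conjugates G S \<times> words G S m)"
    unfolding eq by (rule card_image_le[OF fin])
  also have "\<dots> \<le> card (conjugates G S) ^ Suc m"
    using Suc.IH by (simp add: card_cartesian_product)
  finally show ?case using fin unfolding eq by blast
qed simp

context group
begin

lemma conjugacy_class_closed: "a \<in> carrier G \<Longrightarrow> conjugacy_class G a \<subseteq> carrier G"
  by (auto simp: conjugacy_class_def)

lemma conjugates_closed: "S \<subseteq> carrier G \<Longrightarrow> conjugates G S \<subseteq> carrier G"
  by (auto simp: conjugates_def conjugacy_class_def)

lemma conjugacy_class_conj:
  assumes "a \<in> carrier G" "x \<in> carrier G" "c \<in> conjugacy_class G a"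
  shows "x \<otimes> c \<otimes> inv x \<in> conjugacy_class G a"
proof -
  obtain g where g: "g \<in> carrier G" "c = g \<otimes> a \<otimes> inv g"
    using assms(3) by (auto simp: conjugacy_class_def)
  have "x \<otimes> c \<otimes> inv x = (x \<otimes> g) \<otimes> a \<otimes> inv (x \<otimes> g)"
    using assms g by (simp add: inv_mult_group m_assoc)
  with assms(2) g show ?thesis by (auto simp: conjugacy_class_def)
qed

lemma conjugates_conj:
  assumes "S \<subseteq> carrier G" "x \<in> carrier G" "c \<in> conjugates G S"
  shows "x \<otimes> c \<otimes> inv x \<in> conjugates G S"
proof -
  obtain a where "a \<in> carrier G" "c \<in> conjugacy_class G a" "conjugacy_class G a \<subseteq> conjugates G S"
    using assms(1,3) inv_closed unfolding conjugates_def by blast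
  with assms(2) conjugacy_class_conj show ?thesis by blast
qed

lemma inv_conjugacy_class:
  assumes "a \<in> carrier G" "c \<in> conjugacy_class G a"
  shows "inv c \<in> conjugacy_class G (inv a)"
proof -
  obtain g where g: "g \<in> carrier G" "c = g \<otimes> a \<otimes> inv g"
    using assms(2) by (auto simp: conjugacy_class_def)
  then have "inv c = g \<otimes> inv a \<otimes> inv g"
    using assms(1) by (simp add: inv_mult_group m_assoc)
  with g(1) show ?thesis by (auto simp: conjugacy_class_def)
qed

lemma conjugates_inv:
  assumes "S \<subseteq> carrier G" "c \<in> conjugates G S"
  shows "inv c \<in> conjugates G S"
proof -
  obtain s where s: "s \<in> S" "c \<in> conjugacy_class G s \<or> c \<in> conjugacy_class G (inv s)"
    using assms(2) by (auto simp: conjugates_def)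
  then have "inv c \<in> conjugacy_class G (inv s) \<or> inv c \<in> conjugacy_class G s"
    using assms(1) inv_conjugacy_class[of s c] inv_conjugacy_class[of "inv s" c] by auto
  with s(1) show ?thesis by (auto simp: conjugates_def)
qed

lemma subset_conjugates:
  assumes "S \<subseteq> carrier G"
  shows "S \<subseteq> conjugates G S"
proof
  fix s assume s: "s \<in> S"
  with assms have "s = \<one> \<otimes> s \<otimes> inv \<one>" by auto
  then have "s \<in> conjugacy_class G s" unfolding conjugacy_class_def by blast
  with s show "s \<in> conjugates G S" by (auto simp: conjugates_def)
qed

lemma words_closed: "S \<subseteq> carrier G \<Longrightarrow> words G S m \<subseteq> carrier G"
proof (induction m)
  case (Suc m)
  then show ?case using set_mult_closed[OF conjugates_closed] by simp
qed simp

lemma words_mult: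
  assumes S: "S \<subseteq> carrier G" and "g \<in> words G S a" "h \<in> words G S b"
  shows "g \<otimes> h \<in> words G S (a + b)"
  using assms(2)
proof (induction a arbitrary: g)
  case 0
  then show ?case using assms(3) words_closed[OF S, of b] by auto
next
  case (Suc a)
  then obtain c g' where c: "c \<in> conjugates G S" "g' \<in> words G S a" "g = c \<otimes> g'"
    by (auto simp: set_mult_def)
  then have "g \<otimes> h = c \<otimes> (g' \<otimes> h)"
    using conjugates_closed[OF S] words_closed[OF S] assms(3) by (auto intro!: m_assoc)
  with Suc.IH[OF c(2)] c(1) show ?case by (auto simp: set_mult_def)
qed

lemma words_1: "S \<subseteq> carrier G \<Longrightarrow> words G S 1 = conjugates G S"
proof -
  assume S: "S \<subseteq> carrier G"
  have "(\<lambda>c. c \<otimes> \<one>) ` conjugates G S = (\<lambda>c. c) ` conjugates G S"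
    using conjugates_closed[OF S] by (intro image_cong) auto
  then show ?thesis by (auto simp: set_mult_def)
qed

text \<open>Conjugating letter by letter stays inside \<open>conjugates\<close>, so conjugation
  costs no length. All later savings rest on this.\<close>

lemma words_conj:
  assumes S: "S \<subseteq> carrier G" and x: "x \<in> carrier G" and "g \<in> words G S m"
  shows "x \<otimes> g \<otimes> inv x \<in> words G S m"
  using assms(3)
proof (induction m arbitrary: g)
  case 0
  then show ?case using x by simp
next
  case (Suc m)
  then obtain c h where c: "c \<in> conjugates G S" "h \<in> words G S m" "g = c \<otimes> h"
    by (auto simp: set_mult_def)
  then have cl: "c \<in> carrier G" "h \<in> carrier G"
    using conjugates_closed[OF S] words_closed[OF S] by auto
  have "x \<otimes> g \<otimes> inv x = (x \<otimes> c \<otimes> inv x) \<otimes> (x \<otimes> h \<otimes> inv x)"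
    using x cl c(3) by (simp add: m_assoc) (simp add: m_assoc[symmetric])
  with Suc.IH[OF c(2)] conjugates_conj[OF S x c(1)] show ?case by (auto simp: set_mult_def)
qed

lemma words_inv:
  assumes S: "S \<subseteq> carrier G" and "g \<in> words G S m"
  shows "inv g \<in> words G S m"
  using assms(2)
proof (induction m arbitrary: g)
  case (Suc m)
  then obtain c h where c: "c \<in> conjugates G S" "h \<in> words G S m" "g = c \<otimes> h"
    by (auto simp: set_mult_def)
  then have "inv g = inv h \<otimes> inv c"
    using conjugates_closed[OF S] words_closed[OF S] by (auto intro!: inv_mult_group)
  moreover have "inv c \<in> words G S 1"
    using conjugates_inv[OF S c(1)] words_1[OF S] by simp
  ultimately show ?case using words_mult[OF S Suc.IH[OF c(2)], of "inv c" 1] by simp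
qed simp

text \<open>Shows that there are at most twice as many letters as elements of the class.\<close>

lemma conjugates_conjugacy_class:
  assumes a: "a \<in> carrier G"
  shows "conjugates G {a} = conjugacy_class G a \<union> m_inv G ` conjugacy_class G a"
proof -
  have "conjugacy_class G (inv a) = m_inv G ` conjugacy_class G a"
  proof
    show "m_inv G ` conjugacy_class G a \<subseteq> conjugacy_class G (inv a)"
      using inv_conjugacy_class[OF a] by auto
    show "conjugacy_class G (inv a) \<subseteq> m_inv G ` conjugacy_class G a"
    proof
      fix c assume c: "c \<in> conjugacy_class G (inv a)"
      then have "inv c \<in> conjugacy_class G a" using inv_conjugacy_class[of "inv a" c] a by simp
      moreover have "c = inv (inv c)" using c a conjugacy_class_closed[of "inv a"] by auto
      ultimately show "c \<in> m_inv G ` conjugacy_class G a" by blast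
    qed
  qed
  then show ?thesis by (simp add: conjugates_def)
qed

end

section \<open>Transvections\<close>

locale special_linear =
  fixes n :: nat and l :: int
  assumes n3: "n \<ge> 3" and l2: "l \<ge> 2"
begin

sublocale group "SL n l"
  by (rule group_SL[OF l2])

abbreviation mult_SL (infixl "\<odot>" 70) where "g \<odot> h \<equiv> g \<otimes>\<^bsub>SL n l\<^esub> h"
abbreviation inv_SL where "inv_SL \<equiv> m_inv (SL n l)"

text \<open>Reducing inside the constructor lets matrices be given by arbitrary integer entries and
  compared by congruences, as in \<open>el_eqI\<close>.\<close>

definition el :: "(nat \<Rightarrow> nat \<Rightarrow> int) \<Rightarrow> int mat" where
  "el M = mat n n (\<lambda>(i, j). M i j mod l)"

definition dot :: "(nat \<Rightarrow> int) \<Rightarrow> (nat \<Rightarrow> int) \<Rightarrow> int" where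
  "dot \<phi> u = (\<Sum>k<n. \<phi> k * u k)"

text \<open>The matrix \<open>I + u \<phi>\<^sup>T\<close>, a transvection when
  \<open>dot \<phi> u\<close> vanishes modulo \<open>l\<close>. That condition is a hypothesis of
  the lemmas that rely on it.\<close>

definition tv :: "(nat \<Rightarrow> int) \<Rightarrow> (nat \<Rightarrow> int) \<Rightarrow> int mat" where
  "tv u \<phi> = el (\<lambda>i j. of_bool (i = j) + u i * \<phi> j)"

abbreviation ev :: "nat \<Rightarrow> nat \<Rightarrow> int" where
  "ev i \<equiv> (\<lambda>j. of_bool (j = i))"

lemma el_index [simp]: "i < n \<Longrightarrow> j < n \<Longrightarrow> el M $$ (i, j) = M i j mod l"
  by (simp add: el_def)

lemma el_eqI:
  assumes "\<And>i j. i < n \<Longrightarrow> j < n \<Longrightarrow> [M i j = N i j] (mod l)"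
  shows "el M = el N"
  using assms unfolding el_def by (intro eq_matI) (auto simp: cong_def)

lemma el_entries:
  assumes "g \<in> carrier (SL n l)"
  shows "el (\<lambda>i j. g $$ (i, j)) = g"
proof -
  have "g \<in> carrier_mat n n" "reduce_mat l g = g"
    using assms reduce_mat_id[of g l] by (auto simp: SL_def)
  then show ?thesis unfolding el_def
    by (intro eq_matI) (auto simp: reduce_mat_def mat_eq_iff)
qed

lemma mult_el: "el M \<odot> el N = el (\<lambda>i j. \<Sum>k<n. M i k * N k j)"
proof -
  have "[(\<Sum>k<n. (M i k mod l) * (N k j mod l)) = (\<Sum>k<n. M i k * N k j)] (mod l)" for i j
    by (intro cong_sum cong_mult) auto
  then show ?thesis
    by (intro eq_matI)
       (auto simp: SL_def reduce_mat_def el_def scalar_prod_def cong_def lessThan_atLeast0)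
qed

lemma one_el: "\<one>\<^bsub>SL n l\<^esub> = el (\<lambda>i j. of_bool (i = j))"
  using l2 by (intro eq_matI) (auto simp: SL_def el_def)

lemma el_in_SL:
  assumes "[det (mat n n (\<lambda>(i, j). M i j)) = 1] (mod l)"
  shows "el M \<in> carrier (SL n l)"
proof -
  have "el M = reduce_mat l (mat n n (\<lambda>(i, j). M i j))"
    by (intro eq_matI) (auto simp: el_def reduce_mat_def)
  then show ?thesis
    using assms cong_trans[OF det_reduce_mat assms] reduce_mat_elements[OF l2]
    by (simp add: SL_def)
qed

lemma sum_of_bool_mult:
  fixes f :: "nat \<Rightarrow> int"
  shows "i < n \<Longrightarrow> (\<Sum>k<n. of_bool (i = k) * f k) = f i"
    "i < n \<Longrightarrow> (\<Sum>k<n. f k * of_bool (k = i)) = f i"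
  by (simp_all add: of_bool_def if_distrib if_distribR cong: if_cong)

lemma dot_ev [simp]:
  "i < n \<Longrightarrow> dot (ev i) u = u i"
  "i < n \<Longrightarrow> dot \<phi> (ev i) = \<phi> i"
  using sum_of_bool_mult[of i u] sum_of_bool_mult[of i \<phi>]
  by (simp_all add: dot_def eq_commute[of i])

lemma dot_lin [simp]:
  "dot \<phi> (\<lambda>k. u k + v k) = dot \<phi> u + dot \<phi> v"
  "dot \<phi> (\<lambda>k. u k - v k) = dot \<phi> u - dot \<phi> v"
  "dot \<phi> (\<lambda>k. - u k) = - dot \<phi> u"
  "dot \<phi> (\<lambda>k. s * u k) = s * dot \<phi> u"
  "dot \<phi> (\<lambda>k. u k * s) = dot \<phi> u * s"
  "dot (\<lambda>k. \<phi> k + \<psi> k) u = dot \<phi> u + dot \<psi> u"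
  "dot (\<lambda>k. \<phi> k - \<psi> k) u = dot \<phi> u - dot \<psi> u"
  "dot (\<lambda>k. - \<phi> k) u = - dot \<phi> u"
  "dot (\<lambda>k. s * \<phi> k) u = s * dot \<phi> u"
  "dot (\<lambda>k. \<phi> k * s) u = dot \<phi> u * s"
  by (simp_all add: dot_def sum.distrib sum_subtractf sum_negf sum_distrib_left
      sum_distrib_right algebra_simps)

lemma tv_mult_el: "tv u \<phi> \<odot> el M = el (\<lambda>i j. M i j + u i * dot \<phi> (\<lambda>k. M k j))"
proof -
  have "(\<Sum>k<n. (of_bool (i = k) + u i * \<phi> k) * M k j) = M i j + u i * dot \<phi> (\<lambda>k. M k j)"
    if "i < n" for i j
    unfolding dot_def distrib_right sum.distrib sum_of_bool_mult(1)[OF that]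
    by (simp add: sum_distrib_left mult.assoc)
  then show ?thesis unfolding tv_def mult_el by (intro el_eqI) simp
qed

lemma el_mult_tv: "el M \<odot> tv u \<phi> = el (\<lambda>i j. M i j + dot (M i) u * \<phi> j)"
proof -
  have "(\<Sum>k<n. M i k * (of_bool (k = j) + u k * \<phi> j)) = M i j + dot (M i) u * \<phi> j"
    if "j < n" for i j
    unfolding dot_def distrib_left sum.distrib sum_of_bool_mult(2)[OF that]
    by (simp add: sum_distrib_right mult.assoc)
  then show ?thesis unfolding tv_def mult_el by (intro el_eqI) simp
qed

text \<open>Only the outer product of \<open>u\<close> and \<open>\<phi>\<close> enters
  \<open>tv\<close>, so scalar factors may be shifted between the two vectors.\<close>

lemma tv_cong:
  assumes "\<And>i j. i < n \<Longrightarrow> j < n \<Longrightarrow> [u i * \<phi> j = v i * \<psi> j] (mod l)"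
  shows "tv u \<phi> = tv v \<psi>"
  unfolding tv_def using assms by (intro el_eqI cong_add) auto

lemma tv_zero: "tv (\<lambda>_. 0) \<phi> = \<one>\<^bsub>SL n l\<^esub>"
  by (simp add: tv_def one_el)

text \<open>The cross term of the product carries the factor \<open>dot \<phi> v\<close>, which
  vanishes modulo \<open>l\<close>.\<close>

lemma tv_add_left:
  assumes "[dot \<phi> v = 0] (mod l)"
  shows "tv u \<phi> \<odot> tv v \<phi> = tv (\<lambda>i. u i + v i) \<phi>"
proof -
  have "[(x + v i * y) + u i * (y + dot \<phi> v * y) = x + (u i + v i) * y] (mod l)" for i x y
  proof -
    have "[x + (u i + v i) * y + u i * y * dot \<phi> v = x + (u i + v i) * y + u i * y * 0] (mod l)"
      using assms by (intro cong_add cong_mult) auto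
    then show ?thesis by (simp add: algebra_simps)
  qed
  then show ?thesis
    unfolding tv_def[of v] tv_mult_el unfolding tv_def by (intro el_eqI) simp
qed

lemma tv_inverse:
  assumes "[dot \<phi> u = 0] (mod l)"
  shows "tv u \<phi> \<odot> tv (\<lambda>i. - u i) \<phi> = \<one>\<^bsub>SL n l\<^esub>"
proof -
  have "[dot \<phi> (\<lambda>i. - u i) = 0] (mod l)" using assms by (simp add: cong_0_iff)
  from tv_add_left[OF this, of u] show ?thesis by (simp add: tv_zero)
qed

text \<open>The identity matrix with row \<open>r\<close> replaced by \<open>e\<^sub>r + \<phi>\<close> is built up one
  column of \<open>\<phi>\<close> at a time.\<close>

lemma det_row_transvection:
  fixes \<phi> :: "nat \<Rightarrow> int"
  assumes "r < n" "\<phi> r = 0"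
  shows "det (mat n n (\<lambda>(i, j). of_bool (i = j) + of_bool (i = r) * \<phi> j)) = 1"
proof -
  let ?M = "\<lambda>m. mat n n (\<lambda>(i, j). of_bool (i = j) + of_bool (i = r \<and> j < m) * \<phi> j)"
  have "det (?M m) = 1" if "m \<le> n" for m
    using that
  proof (induction m)
    case 0
    have "?M 0 = 1\<^sub>m n" by (intro eq_matI) auto
    then show ?case by simp
  next
    case (Suc m)
    show ?case
    proof (cases "m = r")
      case True
      then have "?M (Suc m) = ?M m" using assms by (intro eq_matI) (auto simp: less_Suc_eq)
      then show ?thesis using Suc by simp
    next
      case False
      then have "?M (Suc m) = addrow (\<phi> m) r m (?M m)"
        using Suc.prems assms by (intro eq_matI) (auto simp: less_Suc_eq)
      also have "det \<dots> = det (?M m)"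
        using False Suc.prems by (intro det_addrow[of _ n]) auto
      finally show ?thesis using Suc by simp
    qed
  qed
  from this[of n] have "det (?M n) = 1" by simp
  also have "?M n = mat n n (\<lambda>(i, j). of_bool (i = j) + of_bool (i = r) * \<phi> j)"
    by (intro eq_matI) auto
  finally show ?thesis .
qed

lemma tv_row_in_SL:
  assumes "r < n" "\<phi> r = 0"
  shows "tv (\<lambda>i. s * ev r i) \<phi> \<in> carrier (SL n l)"
proof -
  have "mat n n (\<lambda>(i, j). of_bool (i = j) + s * ev r i * \<phi> j) =
      mat n n (\<lambda>(i, j). of_bool (i = j) + of_bool (i = r) * (s * \<phi> j))"
    by (intro eq_matI) auto
  then show ?thesis
    unfolding tv_def using det_row_transvection[of r "\<lambda>j. s * \<phi> j"] assms
    by (intro el_in_SL) simp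
qed

lemma tv_col_in_SL:
  assumes "r < n" "u r = 0"
  shows "tv u (ev r) \<in> carrier (SL n l)"
proof -
  let ?N = "mat n n (\<lambda>(i, j). of_bool (i = j) + of_bool (i = r) * u j)"
  have "mat n n (\<lambda>(i, j). of_bool (i = j) + u i * ev r j) = transpose_mat ?N"
    by (intro eq_matI) auto
  also have "det \<dots> = 1"
    using det_row_transvection[of r u] assms by (subst det_transpose[of _ n]) auto
  finally show ?thesis unfolding tv_def by (intro el_in_SL) simp
qed

text \<open>Membership of both matrices is assumed because it is proved differently for a single
  altered row and for a single altered column.\<close>

lemma inv_tv:
  assumes "tv a \<alpha> \<in> carrier (SL n l)" "tv (\<lambda>i. - a i) \<alpha> \<in> carrier (SL n l)"
    and "[dot \<alpha> a = 0] (mod l)"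
  shows "inv_SL (tv a \<alpha>) = tv (\<lambda>i. - a i) \<alpha>"
  using assms tv_inverse[OF assms(3)] by (metis inv_char inv_comm)

text \<open>Supplies the third index needed by the double commutator and by the detour in
  \<open>elementary_move\<close>.\<close>

lemma other_index:
  obtains k where "k < n" "k \<noteq> i" "k \<noteq> j"
proof -
  have "\<not> {..<3} \<subseteq> {i, j}"
    using card_mono[of "{i, j}" "{..<3::nat}"] card_insert_le_m1[of 2 "{j}" i] by auto
  then obtain k where "k < 3" "k \<notin> {i, j}" by blast
  with that[of k] n3 show thesis by simp
qed

text \<open>Conjugation by \<open>g\<close> sends \<open>I + u \<phi>\<^sup>T\<close> to
  \<open>I + (g u) (\<phi>\<^sup>T g\<inverse>)\<close>; here \<open>g\<close> is itself a
  transvection, so both vectors have explicit images.\<close>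

lemma conj_tv:
  assumes a: "tv a \<alpha> \<in> carrier (SL n l)" "tv (\<lambda>i. - a i) \<alpha> \<in> carrier (SL n l)"
    and 0: "[dot \<alpha> a = 0] (mod l)"
  shows "tv a \<alpha> \<odot> tv u \<phi> \<odot> inv_SL (tv a \<alpha>) =
    tv (\<lambda>i. u i + dot \<alpha> u * a i) (\<lambda>j. \<phi> j - dot \<phi> a * \<alpha> j)"
proof -
  have "inv_SL (tv a \<alpha>) = tv (\<lambda>i. - a i) \<alpha>"
    using a 0 by (rule inv_tv)
  moreover have "tv a \<alpha> \<odot> tv u \<phi> =
      el (\<lambda>i j. of_bool (i = j) + u i * \<phi> j + a i * (\<alpha> j + dot \<alpha> u * \<phi> j))"
    unfolding tv_def[of u] tv_mult_el by (intro el_eqI) simp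
  ultimately have "tv a \<alpha> \<odot> tv u \<phi> \<odot> inv_SL (tv a \<alpha>) =
      el (\<lambda>i j. of_bool (i = j) + u i * \<phi> j + a i * (\<alpha> j + dot \<alpha> u * \<phi> j)
        - dot (\<lambda>j. of_bool (i = j) + u i * \<phi> j + a i * (\<alpha> j + dot \<alpha> u * \<phi> j)) a * \<alpha> j)"
    by (simp only: el_mult_tv) (simp add: algebra_simps)
  also have "\<dots> = tv (\<lambda>i. u i + dot \<alpha> u * a i) (\<lambda>j. \<phi> j - dot \<phi> a * \<alpha> j)"
    unfolding tv_def
  proof (rule el_eqI)
    fix i j assume ij: "i < n" "j < n"
    let ?L = "of_bool (i = j) + u i * \<phi> j + a i * (\<alpha> j + dot \<alpha> u * \<phi> j)
        - dot (\<lambda>j. of_bool (i = j) + u i * \<phi> j + a i * (\<alpha> j + dot \<alpha> u * \<phi> j)) a * \<alpha> j"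
    let ?R = "of_bool (i = j) + (u i + dot \<alpha> u * a i) * (\<phi> j - dot \<phi> a * \<alpha> j)"
    have "dot (\<lambda>j. of_bool (i = j)) a = a i"
      using ij dot_ev(1)[of i a] by (simp add: eq_commute)
    \<comment> \<open>An exact identity over the integers; its last term is a multiple of
      \<open>dot \<alpha> a\<close> and disappears modulo \<open>l\<close>.\<close>
    then have "?L = ?R - a i * \<alpha> j * dot \<alpha> a"
      by (simp add: algebra_simps)
    moreover have "[?R - a i * \<alpha> j * dot \<alpha> a = ?R - a i * \<alpha> j * 0] (mod l)"
      using 0 by (intro cong_diff cong_mult) auto
    ultimately show "[?L = ?R] (mod l)" by (simp only: mult_zero_right diff_zero)
  qed
  finally show ?thesis .
qed

lemma inv_entries:
  assumes "g \<in> carrier (SL n l)" "i < n" "j < n"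
  shows "[(\<Sum>k<n. g $$ (i, k) * inv_SL g $$ (k, j)) = of_bool (i = j)] (mod l)"
    "[(\<Sum>k<n. inv_SL g $$ (i, k) * g $$ (k, j)) = of_bool (i = j)] (mod l)"
proof -
  have "[(\<Sum>k<n. g $$ (i, k) * h $$ (k, j)) = of_bool (i = j)] (mod l)"
    if "g \<odot> h = \<one>\<^bsub>SL n l\<^esub>" "g \<in> carrier (SL n l)" "h \<in> carrier (SL n l)" for g h
  proof -
    have "el (\<lambda>i j. \<Sum>k<n. g $$ (i, k) * h $$ (k, j)) = el (\<lambda>i j. of_bool (i = j))"
      using mult_el[of "\<lambda>i j. g $$ (i, j)" "\<lambda>i j. h $$ (i, j)"] that
      by (simp only: el_entries one_el)
    from arg_cong[OF this, of "\<lambda>M. M $$ (i, j)"] show ?thesis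
      using assms(2,3) by (simp only: el_index cong_def)
  qed
  then show "[(\<Sum>k<n. g $$ (i, k) * inv_SL g $$ (k, j)) = of_bool (i = j)] (mod l)"
    "[(\<Sum>k<n. inv_SL g $$ (i, k) * g $$ (k, j)) = of_bool (i = j)] (mod l)"
    using assms(1) by simp_all
qed

lemma conj_tv_general:
  assumes g: "g \<in> carrier (SL n l)"
  shows "g \<odot> tv u \<phi> \<odot> inv_SL g =
    tv (\<lambda>i. dot (\<lambda>k. g $$ (i, k)) u) (\<lambda>j. dot \<phi> (\<lambda>k. inv_SL g $$ (k, j)))"
proof -
  let ?h = "\<lambda>i j. inv_SL g $$ (i, j)"
  have "g \<odot> tv u \<phi> = el (\<lambda>i j. g $$ (i, j) + dot (\<lambda>k. g $$ (i, k)) u * \<phi> j)"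
    using el_mult_tv[of "\<lambda>i j. g $$ (i, j)" u \<phi>] el_entries[OF g] by simp
  then have "g \<odot> tv u \<phi> \<odot> inv_SL g =
      el (\<lambda>i j. \<Sum>k<n. (g $$ (i, k) + dot (\<lambda>k. g $$ (i, k)) u * \<phi> k) * ?h k j)"
    using mult_el[of "\<lambda>i j. g $$ (i, j) + dot (\<lambda>k. g $$ (i, k)) u * \<phi> j" ?h]
    by (simp only: el_entries[OF inv_closed[OF g]])
  also have "\<dots> = tv (\<lambda>i. dot (\<lambda>k. g $$ (i, k)) u) (\<lambda>j. dot \<phi> (\<lambda>k. ?h k j))"
    unfolding tv_def
  proof (rule el_eqI)
    fix i j assume ij: "i < n" "j < n"
    have "(\<Sum>k<n. (g $$ (i, k) + dot (\<lambda>k. g $$ (i, k)) u * \<phi> k) * ?h k j) =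
        (\<Sum>k<n. g $$ (i, k) * ?h k j) + dot (\<lambda>k. g $$ (i, k)) u * dot \<phi> (\<lambda>k. ?h k j)"
      by (simp add: dot_def[of \<phi>] distrib_right sum.distrib sum_distrib_left mult.assoc)
    with cong_add[OF inv_entries(1)[OF g ij] cong_refl]
    show "[(\<Sum>k<n. (g $$ (i, k) + dot (\<lambda>k. g $$ (i, k)) u * \<phi> k) * ?h k j) =
        of_bool (i = j) + dot (\<lambda>k. g $$ (i, k)) u * dot \<phi> (\<lambda>k. ?h k j)] (mod l)"
      by (simp only:)
  qed
  finally show ?thesis .
qed

section \<open>Elementary matrices as products of conjugates\<close>

text \<open>By contraposition: if all off-diagonal entries and all differences of diagonal entries
  vanish modulo \<open>p\<close>, the reduction is the scalar
  \<open>A $$ (0, 0) mod p\<close>.\<close>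

lemma nonscalar_entries:
  assumes A: "A \<in> carrier (SL n l)" and p: "p > 0"
    and ns: "\<not> scalar_mat n p (reduce_mat p A)"
  obtains i j where "i < n" "j < n" "i \<noteq> j" "\<not> p dvd A $$ (i, j) \<or> \<not> p dvd A $$ (j, j) - A $$ (i, i)"
proof (rule ccontr)
  assume "\<not> thesis"
  with that have *: "p dvd A $$ (i, j) \<and> p dvd A $$ (j, j) - A $$ (i, i)"
    if "i < n" "j < n" "i \<noteq> j" for i j
    using that by blast
  have carr: "A \<in> carrier_mat n n" using A by (auto simp: SL_def)
  have "reduce_mat p A = (A $$ (0, 0) mod p) \<cdot>\<^sub>m 1\<^sub>m n"
  proof (rule eq_matI)
    fix i j assume "i < dim_row ((A $$ (0, 0) mod p) \<cdot>\<^sub>m 1\<^sub>m n)"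
      "j < dim_col ((A $$ (0, 0) mod p) \<cdot>\<^sub>m 1\<^sub>m n)"
    then have ij: "i < n" "j < n" by auto
    have "A $$ (i, i) mod p = A $$ (0, 0) mod p"
      using *[of 0 i] ij by (cases "i = 0") (auto simp: mod_eq_dvd_iff)
    then show "reduce_mat p A $$ (i, j) = ((A $$ (0, 0) mod p) \<cdot>\<^sub>m 1\<^sub>m n) $$ (i, j)"
      using *[of i j] ij carr by (auto simp: reduce_mat_def)
  qed (use carr in \<open>auto simp: reduce_mat_def\<close>)
  moreover have "A $$ (0, 0) mod p \<in> carrier (residue_ring p)"
    using p by (simp add: residue_ring_def)
  ultimately show False using ns unfolding scalar_mat_def by blast
qed

text \<open>If neither \<open>(i, j)\<close> nor \<open>(j, i)\<close> already holds a unit at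
  \<open>p\<close>, the difference of the two diagonal entries is one, and conjugation by
  \<open>I + e\<^sub>i e\<^sub>j\<^sup>T\<close> brings it to position
  \<open>(i, j)\<close>.\<close>

lemma conj_with_offdiagonal_unit:
  assumes A: "A \<in> carrier (SL n l)" and p: "prime p" "p dvd l"
    and ns: "\<not> scalar_mat n p (reduce_mat p A)"
  obtains g i j where "g \<in> carrier (SL n l)" "i < n" "j < n" "i \<noteq> j"
    "\<not> p dvd (g \<odot> A \<odot> inv_SL g) $$ (i, j)"
proof -
  obtain i j where ij: "i < n" "j < n" "i \<noteq> j"
    and or: "\<not> p dvd A $$ (i, j) \<or> \<not> p dvd A $$ (j, j) - A $$ (i, i)"
    using nonscalar_entries[OF A _ ns] p(1) prime_gt_0_int by blast
  show thesis
  proof (cases "p dvd A $$ (i, j) \<and> p dvd A $$ (j, i)")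
    case False
    then show thesis using that[of "\<one>\<^bsub>SL n l\<^esub>"] ij A by fastforce
  next
    case True
    have T: "tv (ev i) (ev j) \<in> carrier (SL n l)" "tv (\<lambda>a. - ev i a) (ev j) \<in> carrier (SL n l)"
      using ij by (auto intro!: tv_col_in_SL)
    have inv: "inv_SL (tv (ev i) (ev j)) = tv (\<lambda>a. - ev i a) (ev j)"
      using T ij by (intro inv_tv) auto
    let ?B = "tv (ev i) (ev j) \<odot> A \<odot> inv_SL (tv (ev i) (ev j))"
    have "tv (ev i) (ev j) \<odot> A = el (\<lambda>a b. A $$ (a, b) + ev i a * A $$ (j, b))"
      using tv_mult_el[of "ev i" "ev j" "\<lambda>a b. A $$ (a, b)"] ij by (simp add: el_entries[OF A])
    then have "?B = el (\<lambda>a b. A $$ (a, b) + ev i a * A $$ (j, b)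
        + dot (\<lambda>b. A $$ (a, b) + ev i a * A $$ (j, b)) (\<lambda>a. - ev i a) * ev j b)"
      unfolding inv by (simp only: el_mult_tv)
    then have "?B $$ (i, j) = (A $$ (i, j) - A $$ (j, i) + (A $$ (j, j) - A $$ (i, i))) mod l"
      using ij by (simp add: algebra_simps)
    moreover have "\<not> p dvd A $$ (i, j) - A $$ (j, i) + (A $$ (j, j) - A $$ (i, i))"
      using True or by (auto simp: dvd_add_right_iff)
    ultimately have "\<not> p dvd ?B $$ (i, j)" using p(2) by (simp add: dvd_mod_iff)
    then show thesis using that T ij by blast
  qed
qed

text \<open>Otherwise column \<open>j\<close> of the inverse is a multiple of
  \<open>e\<^sub>j\<close> modulo \<open>p\<close>. Multiplying it by \<open>A\<close> must give
  \<open>e\<^sub>j\<close>: row \<open>i\<close> forces the multiple to be 0, row \<open>j\<close>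
  forces it to be nonzero.\<close>

lemma inverse_column_unit:
  assumes A: "A \<in> carrier (SL n l)" and p: "prime p" "p dvd l"
    and ij: "i < n" "j < n" "i \<noteq> j" and unit: "\<not> p dvd A $$ (i, j)"
  obtains m where "m < n" "m \<noteq> j" "\<not> p dvd inv_SL A $$ (m, j)"
proof (rule ccontr)
  assume "\<not> thesis"
  with that have z: "p dvd inv_SL A $$ (m, j)" if "m < n" "m \<noteq> j" for m using that by blast
  have "[A $$ (a, j) * inv_SL A $$ (j, j) = of_bool (a = j)] (mod p)" if a: "a < n" for a
  proof -
    have "p dvd (\<Sum>k\<in>{..<n} - {j}. A $$ (a, k) * inv_SL A $$ (k, j))"
      using z by (intro dvd_sum) auto
    moreover have "(\<Sum>k<n. A $$ (a, k) * inv_SL A $$ (k, j)) = A $$ (a, j) * inv_SL A $$ (j, j) +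
        (\<Sum>k\<in>{..<n} - {j}. A $$ (a, k) * inv_SL A $$ (k, j))"
      using ij by (intro sum.remove) auto
    moreover have "[(\<Sum>k<n. A $$ (a, k) * inv_SL A $$ (k, j)) = of_bool (a = j)] (mod p)"
      using inv_entries(1)[OF A a ij(2)] p(2) by (rule cong_dvd_modulus)
    ultimately show ?thesis by (simp add: cong_iff_dvd_diff dvd_add_right_iff add_diff_eq[symmetric]
        add.commute[of _ "sum _ _"])
  qed
  from this[OF ij(1)] this[OF ij(2)]
  have "p dvd A $$ (i, j) * inv_SL A $$ (j, j)" "[A $$ (j, j) * inv_SL A $$ (j, j) = 1] (mod p)"
    using ij(3) by (simp_all add: cong_0_iff)
  then have "p dvd inv_SL A $$ (j, j)" "\<not> p dvd A $$ (j, j) * inv_SL A $$ (j, j)"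
    using p(1) unit by (auto simp: prime_dvd_mult_iff cong_dvd_iff)
  then show False by simp
qed

text \<open>The double commutator \<open>[[A, T], F]\<close> with \<open>T = I + e\<^sub>j e\<^sub>m\<^sup>T\<close> and \<open>F = I + s e\<^sub>j \<chi>\<^sup>T\<close>, where
  \<open>\<chi>\<close> annihilates both \<open>e\<^sub>j\<close> and \<open>A e\<^sub>j\<close>.\<close>

lemma double_commutator:
  assumes S: "S \<subseteq> carrier (SL n l)" and A: "A \<in> words (SL n l) S 1"
    and idx: "i < n" "j < n" "k < n" "m < n" "i \<noteq> j" "k \<noteq> j" "m \<noteq> j"
  defines "w \<equiv> \<lambda>a. A $$ (a, j)"
  defines "\<chi> \<equiv> \<lambda>b. w i * ev k b - w k * ev i b"
  shows "tv (\<lambda>a. s * inv_SL A $$ (m, j) * w a) \<chi> \<in> words (SL n l) S 4"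
proof -
  let ?G = "SL n l"
  have AG: "A \<in> carrier ?G" using A words_closed[OF S] by blast
  define \<rho> where "\<rho> = (\<lambda>b. inv_SL A $$ (m, b))"
  define T where "T = tv (ev j) (ev m)"
  define F where "F = tv (\<lambda>a. s * ev j a) \<chi>"
  have T: "T \<in> carrier ?G" "tv (\<lambda>a. - ev j a) (ev m) \<in> carrier ?G"
    unfolding T_def using idx by (auto intro!: tv_col_in_SL)
  have invT: "inv_SL T = tv (\<lambda>a. - ev j a) (ev m)"
    using T idx unfolding T_def by (intro inv_tv) auto
  have \<chi>: "\<chi> j = 0" "dot \<chi> w = 0" "dot \<chi> (ev j) = 0"
    using idx by (auto simp: \<chi>_def)
  have F: "F \<in> carrier ?G" "tv (\<lambda>a. (- s) * ev j a) \<chi> \<in> carrier ?G"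
    unfolding F_def using idx \<chi>(1) by (auto intro: tv_row_in_SL simp del: mult_minus_left)
  have invF: "inv_SL F = tv (\<lambda>a. - (s * ev j a)) \<chi>"
    using F \<chi>(3) unfolding F_def by (intro inv_tv) auto
  \<comment> \<open>\<open>X\<close> is again of transvection shape: its column is
    \<open>w = A e\<^sub>j\<close> and its row is row \<open>m\<close> of the inverse of
    \<open>A\<close>.\<close>
  define X where "X = A \<odot> T \<odot> inv_SL A"
  have X: "X = tv w \<rho>"
    unfolding X_def T_def conj_tv_general[OF AG] using idx by (simp add: w_def \<rho>_def)
  have "inv_SL X = A \<odot> inv_SL T \<odot> inv_SL A"
    unfolding X_def using AG T by (simp add: inv_mult_group m_assoc)
  then have invX: "inv_SL X = tv (\<lambda>a. - w a) \<rho>"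
    unfolding invT conj_tv_general[OF AG] using idx by (simp add: w_def \<rho>_def)
  have XG: "X \<in> carrier ?G" "inv_SL X \<in> carrier ?G" unfolding X_def using AG T by auto
  have \<rho>w: "[dot \<rho> w = 0] (mod l)"
    using inv_entries(2)[OF AG idx(4) idx(2)] idx by (simp add: dot_def \<rho>_def w_def)
  \<comment> \<open>\<open>B\<close> is the inner commutator \<open>[A, T]\<close>. Regrouped as
    \<open>A\<close> times a conjugate of its inverse, it has length 2.\<close>
  define B where "B = X \<odot> inv_SL T"
  have BG: "B \<in> carrier ?G" unfolding B_def using XG T by simp
  have "B = A \<odot> (T \<odot> inv_SL A \<odot> inv_SL T)"
    unfolding B_def X_def using AG T by (simp add: m_assoc)
  then have B2: "B \<in> words ?G S 2"
    using words_mult[OF S A words_conj[OF S T(1) words_inv[OF S A]]] by (simp add: numeral_2_eq_2)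
  \<comment> \<open>\<open>T\<close> and \<open>F\<close> commute, since \<open>\<chi>\<close> kills
    \<open>e\<^sub>j\<close> and \<open>m \<noteq> j\<close>. Hence conjugating \<open>F\<close> by
    \<open>B\<close> amounts to conjugating by \<open>X\<close>.\<close>
  have TF: "inv_SL T \<odot> F \<odot> inv_SL (inv_SL T) = F"
    unfolding invT F_def using T idx \<chi> by (subst conj_tv) (auto simp: T_def)
  have "B \<odot> F \<odot> inv_SL B = X \<odot> (inv_SL T \<odot> F \<odot> inv_SL (inv_SL T)) \<odot> inv_SL X"
    unfolding B_def using XG T F by (simp add: inv_mult_group m_assoc)
  also have "\<dots> = tv (\<lambda>a. s * ev j a + s * \<rho> j * w a) \<chi>"
    unfolding TF unfolding X F_def using XG[unfolded invX] \<rho>w idx \<chi>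
    by (subst conj_tv) (auto simp: X)
  finally have BFB: "B \<odot> F \<odot> inv_SL B = tv (\<lambda>a. s * ev j a + s * \<rho> j * w a) \<chi>" .
  \<comment> \<open>Multiplying by the inverse of \<open>F\<close> cancels the summand
    \<open>s e\<^sub>j\<close>, leaving the multiple of \<open>w\<close>; the two halves
    \<open>B\<close> and \<open>F B\<inverse> F\<inverse>\<close> have length 2 each.\<close>
  have "B \<odot> (F \<odot> inv_SL B \<odot> inv_SL F) = B \<odot> F \<odot> inv_SL B \<odot> inv_SL F"
    using BG F by (simp add: m_assoc)
  also have "\<dots> = tv (\<lambda>a. s * inv_SL A $$ (m, j) * w a) \<chi>"
    unfolding BFB invF using \<chi>(3) by (subst tv_add_left) (simp_all add: \<rho>_def)
  finally show ?thesis
    using words_mult[OF S B2 words_conj[OF S F(1) words_inv[OF S B2]]] by simp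
qed

text \<open>Conjugation by \<open>I - c' (w - c e\<^sub>i) e\<^sub>i\<^sup>T\<close> takes \<open>w\<close> to \<open>c e\<^sub>i\<close> in the local factor.\<close>

lemma local_elementary:
  assumes S: "S \<subseteq> carrier (SL n l)" and A: "A \<in> S" and p: "prime p" "p dvd l"
    and ns: "\<not> scalar_mat n p (reduce_mat p A)"
    and e: "\<And>c. \<not> p dvd c \<Longrightarrow> \<exists>c'. [e * (c * c') = e] (mod l)"
  obtains i k where "i < n" "k < n" "i \<noteq> k"
    "\<And>s. tv (\<lambda>a. s * e * ev i a) (ev k) \<in> words (SL n l) S 4"
proof -
  let ?G = "SL n l"
  have AG: "A \<in> carrier ?G" using A S by blast
  obtain g i j where g: "g \<in> carrier ?G" and ij: "i < n" "j < n" "i \<noteq> j"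
    and c: "\<not> p dvd (g \<odot> A \<odot> inv_SL g) $$ (i, j)"
    using conj_with_offdiagonal_unit[OF AG p ns] .
  define A' where "A' = g \<odot> A \<odot> inv_SL g"
  have A'G: "A' \<in> carrier ?G" unfolding A'_def using AG g by simp
  have "A \<in> words ?G S 1" using A subset_conjugates[OF S] words_1[OF S] by blast
  then have A'1: "A' \<in> words ?G S 1" unfolding A'_def by (rule words_conj[OF S g])
  obtain m where m: "m < n" "m \<noteq> j" "\<not> p dvd inv_SL A' $$ (m, j)"
    using inverse_column_unit[OF A'G p ij c[folded A'_def]] .
  obtain k where k: "k < n" "k \<noteq> i" "k \<noteq> j"
    by (rule other_index)
  define c d where "c = A' $$ (i, j)" and "d = inv_SL A' $$ (m, j)"
  define w where "w = (\<lambda>a. A' $$ (a, j))"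
  define \<chi> where "\<chi> = (\<lambda>b. c * ev k b - w k * ev i b)"
  obtain c' where c': "[e * (c * c') = e] (mod l)" using e c unfolding c_def A'_def by blast
  obtain d' where d': "[e * (d * d') = e] (mod l)" using e m(3) unfolding d_def by blast
  define u where "u = (\<lambda>a. - (c' * (w a - c * ev i a)))"
  have ui: "u i = 0" by (simp add: u_def w_def c_def)
  then have g1: "tv u (ev i) \<in> carrier ?G" "tv (\<lambda>a. - u a) (ev i) \<in> carrier ?G"
    using ij by (auto intro!: tv_col_in_SL)
  have "tv (\<lambda>a. s * e * ev i a) (ev k) \<in> words ?G S 4" for s
  proof -
    \<comment> \<open>The factor \<open>d\<close> comes from the double commutator and is cancelled
      locally by \<open>d'\<close>. One \<open>c'\<close> cancels the \<open>c\<close> of the column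
      \<open>c e\<^sub>i\<close>, the other the \<open>c\<close> in front of \<open>ev k\<close> in
      \<open>\<chi>\<close>.\<close>
    define t where "t = s * e * d' * c' * c' * d"
    have "tv (\<lambda>a. t * w a) \<chi> \<in> words ?G S 4"
      using double_commutator[OF S A'1 ij(1,2) k(1) m(1) ij(3) k(3) m(2), of "s * e * d' * c' * c'"]
      unfolding t_def w_def \<chi>_def c_def d_def .
    then have "tv u (ev i) \<odot> tv (\<lambda>a. t * w a) \<chi> \<odot> inv_SL (tv u (ev i)) \<in> words ?G S 4"
      by (rule words_conj[OF S g1(1)])
    also have "tv u (ev i) \<odot> tv (\<lambda>a. t * w a) \<chi> \<odot> inv_SL (tv u (ev i)) =
        tv (\<lambda>a. t * w a + t * c * u a) (\<lambda>b. \<chi> b + c * c' * w k * ev i b)"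
    proof -
      have "dot \<chi> u = - (c * c' * w k)"
        using k ij ui by (simp add: \<chi>_def) (simp add: u_def)
      then show ?thesis
        using g1 ij ui by (subst conj_tv) (auto simp: w_def c_def)
    qed
    also have "\<dots> = tv (\<lambda>a. s * e * ev i a) (ev k)"
    proof (rule tv_cong)
      fix a b
      obtain x y z where xyz: "x = ev i a" "y = ev k b" "z = ev i b" by blast
      let ?X = "c * c'" and ?Y = "d * d'"
      \<comment> \<open>An integer identity exhibiting the difference as a combination of
        \<open>e * ?Y - e\<close> and \<open>e * ?X - e\<close>, both of which are divisible by
        \<open>l\<close>.\<close>
      have "(t * w a + t * c * u a) * (\<chi> b + ?X * w k * z) - s * e * x * y =
          (e * ?Y - e) * (s * c' * c' * (w a - ?X * (w a - c * x)) * (c * y - w k * z + ?X * w k * z))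
        + (e * ?X - e) * (s * (c' * c' * (?X * c * x * w k * z - w a * (c * y - w k * z + ?X * w k * z))
            + (?X * ?X + ?X + 1) * x * y))"
        unfolding t_def u_def \<chi>_def xyz[symmetric] by (simp add: algebra_simps)
      moreover have "l dvd e * ?X - e" "l dvd e * ?Y - e"
        using c' d' by (simp_all add: cong_iff_dvd_diff)
      ultimately have "l dvd (t * w a + t * c * u a) * (\<chi> b + ?X * w k * z) - s * e * x * y"
        by (simp only: dvd_add dvd_mult2)
      then show "[(t * w a + t * c * u a) * (\<chi> b + ?X * w k * ev i b) = s * e * ev i a * ev k b] (mod l)"
        unfolding xyz by (simp add: cong_iff_dvd_diff)
    qed
    finally show ?thesis .
  qed
  with that[of i k] ij k show thesis by auto
qed

section \<open>Moving an elementary matrix to another position by conjugation\<close>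

lemma elementary_move_row:
  assumes S: "S \<subseteq> carrier (SL n l)" and idx: "i < n" "i' < n" "k < n" "i \<noteq> k" "i' \<noteq> k"
    and W: "tv (\<lambda>a. x * ev i a) (ev k) \<in> words (SL n l) S m"
  shows "tv (\<lambda>a. x * ev i' a) (ev k) \<in> words (SL n l) S m"
proof (cases "i = i'")
  case False
  have T: "tv (ev i') (ev i) \<in> carrier (SL n l)" "tv (\<lambda>a. - ev i' a) (ev i) \<in> carrier (SL n l)"
    "tv (ev i) (ev i') \<in> carrier (SL n l)" "tv (\<lambda>a. - ev i a) (ev i') \<in> carrier (SL n l)"
    using idx False by (auto intro!: tv_col_in_SL)
  \<comment> \<open>The first conjugation copies the entry from row \<open>i\<close> to row
    \<open>i'\<close>; the second, by \<open>T(4)\<close>, erases the original.\<close>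
  have "tv (ev i') (ev i) \<odot> tv (\<lambda>a. x * ev i a) (ev k) \<odot> inv_SL (tv (ev i') (ev i)) =
      tv (\<lambda>a. x * ev i a + x * ev i' a) (ev k)"
    using T idx False by (subst conj_tv) auto
  then have "tv (\<lambda>a. x * ev i a + x * ev i' a) (ev k) \<in> words (SL n l) S m"
    using words_conj[OF S T(1) W] by simp
  from words_conj[OF S T(4) this] show ?thesis
    using T idx False by (subst (asm) conj_tv) auto
qed (use W in simp)

lemma elementary_move_col:
  assumes S: "S \<subseteq> carrier (SL n l)" and idx: "i < n" "k < n" "k' < n" "i \<noteq> k" "i \<noteq> k'"
    and W: "tv (\<lambda>a. x * ev i a) (ev k) \<in> words (SL n l) S m"
  shows "tv (\<lambda>a. x * ev i a) (ev k') \<in> words (SL n l) S m"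
proof (cases "k = k'")
  case False
  have T: "tv (ev k) (ev k') \<in> carrier (SL n l)" "tv (\<lambda>a. - ev k a) (ev k') \<in> carrier (SL n l)"
    "tv (ev k') (ev k) \<in> carrier (SL n l)" "tv (\<lambda>a. - ev k' a) (ev k) \<in> carrier (SL n l)"
    using idx False by (auto intro!: tv_col_in_SL)
  \<comment> \<open>Dually, the row vector first gains the coordinate \<open>k'\<close> and then
    loses \<open>k\<close>.\<close>
  have "tv (\<lambda>a. - ev k a) (ev k') \<odot> tv (\<lambda>a. x * ev i a) (ev k) \<odot> inv_SL (tv (\<lambda>a. - ev k a) (ev k')) =
      tv (\<lambda>a. x * ev i a) (\<lambda>b. ev k b + ev k' b)"
    using T idx False by (subst conj_tv) auto
  then have "tv (\<lambda>a. x * ev i a) (\<lambda>b. ev k b + ev k' b) \<in> words (SL n l) S m"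
    using words_conj[OF S T(2) W] by simp
  from words_conj[OF S T(3) this] show ?thesis
    using T idx False by (subst (asm) conj_tv) auto
qed (use W in simp)

text \<open>Row first, then column, unless \<open>i' = k\<close>, where the intermediate position
  would be diagonal; then a third column \<open>q\<close> is used as a detour.\<close>

lemma elementary_move:
  assumes S: "S \<subseteq> carrier (SL n l)"
    and idx: "i < n" "k < n" "i \<noteq> k" "i' < n" "k' < n" "i' \<noteq> k'"
    and W: "tv (\<lambda>a. x * ev i a) (ev k) \<in> words (SL n l) S m"
  shows "tv (\<lambda>a. x * ev i' a) (ev k') \<in> words (SL n l) S m"
proof (cases "i' = k")
  case False
  show ?thesis
    using elementary_move_col[OF S _ _ _ _ _ elementary_move_row[OF S _ _ _ _ _ W]] idx False
    by auto
next
  case True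
  obtain q where q: "q < n" "q \<noteq> i" "q \<noteq> k"
    by (rule other_index)
  have "tv (\<lambda>a. x * ev i a) (ev q) \<in> words (SL n l) S m"
    using elementary_move_col[OF S _ _ _ _ _ W] idx q by auto
  then have "tv (\<lambda>a. x * ev i' a) (ev q) \<in> words (SL n l) S m"
    using elementary_move_row[OF S, of i i' q] idx q True by auto
  then show ?thesis
    using elementary_move_col[OF S, of i' q k'] idx q True by auto
qed

section \<open>Transvections with a full column or row, first locally and then over
  \<open>\<int>/l\<close>\<close>

lemma local_col_transvection:
  assumes S: "S \<subseteq> carrier (SL n l)" and p: "prime p"
    and e: "\<And>c. \<not> p dvd c \<Longrightarrow> \<exists>c'. [e * (c * c') = e] (mod l)"
    and W: "\<And>i k s. i < n \<Longrightarrow> k < n \<Longrightarrow> i \<noteq> k \<Longrightarrow>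
      tv (\<lambda>a. s * e * ev i a) (ev k) \<in> words (SL n l) S m"
    and r: "r < n" "v r = 0"
  shows "tv (\<lambda>a. e * v a) (ev r) \<in> words (SL n l) S m"
proof -
  have J: "finite ({..<n} - {r})" "{..<n} - {r} \<noteq> {}"
  proof -
    have "(if r = 0 then 1 else 0) \<in> {..<n} - {r}" using n3 by auto
    then show "{..<n} - {r} \<noteq> {}" by blast
  qed simp
  obtain i z where i: "i < n" "i \<noteq> r"
    and z: "\<And>j. j < n \<Longrightarrow> j \<noteq> r \<Longrightarrow> [e * v j = e * (v i * z j)] (mod l)"
    using local_dvd_minimum[OF p e J, of v] by (auto simp: Ball_def) metis
  \<comment> \<open>Conjugating an elementary matrix at the pivot \<open>i\<close> by
    \<open>I + y e\<^sub>i\<^sup>T\<close> fills in the other entries. The zero at \<open>i\<close>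
    puts the conjugator in the group; the zero at \<open>r\<close> leaves the row
    \<open>ev r\<close> unchanged.\<close>
  define y where "y = (\<lambda>j. if j = i \<or> j = r then 0 else z j)"
  have T: "tv y (ev i) \<in> carrier (SL n l)" "tv (\<lambda>a. - y a) (ev i) \<in> carrier (SL n l)"
    using i by (auto intro!: tv_col_in_SL simp: y_def)
  have "tv y (ev i) \<odot> tv (\<lambda>a. v i * e * ev i a) (ev r) \<odot> inv_SL (tv y (ev i)) =
      tv (\<lambda>a. v i * e * ev i a + v i * e * y a) (ev r)"
    using T i r by (subst conj_tv) (auto simp: y_def)
  also have "\<dots> = tv (\<lambda>a. e * v a) (ev r)"
  proof (rule tv_cong, rule cong_mult[OF _ cong_refl])
    fix a assume "a < n"
    then show "[v i * e * ev i a + v i * e * y a = e * v a] (mod l)"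
      using z[of a] r(2) i(2) by (auto simp: y_def algebra_simps intro: cong_sym)
  qed
  finally show ?thesis using words_conj[OF S T(1) W[OF i(1) r(1) i(2), of "v i"]] by simp
qed

lemma local_row_transvection:
  assumes S: "S \<subseteq> carrier (SL n l)" and p: "prime p"
    and e: "\<And>c. \<not> p dvd c \<Longrightarrow> \<exists>c'. [e * (c * c') = e] (mod l)"
    and W: "\<And>i k s. i < n \<Longrightarrow> k < n \<Longrightarrow> i \<noteq> k \<Longrightarrow>
      tv (\<lambda>a. s * e * ev i a) (ev k) \<in> words (SL n l) S m"
    and r: "r < n" "v r = 0"
  shows "tv (ev r) (\<lambda>b. e * v b) \<in> words (SL n l) S m"
proof -
  have J: "finite ({..<n} - {r})" "{..<n} - {r} \<noteq> {}"
  proof -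
    have "(if r = 0 then 1 else 0) \<in> {..<n} - {r}" using n3 by auto
    then show "{..<n} - {r} \<noteq> {}" by blast
  qed simp
  obtain i z where i: "i < n" "i \<noteq> r"
    and z: "\<And>j. j < n \<Longrightarrow> j \<noteq> r \<Longrightarrow> [e * v j = e * (v i * z j)] (mod l)"
    using local_dvd_minimum[OF p e J, of v] by (auto simp: Ball_def) metis
  \<comment> \<open>The sign is opposite to the column case because conjugation acts on row vectors
    through the inverse.\<close>
  define y where "y = (\<lambda>j. if j = i \<or> j = r then 0 else - z j)"
  have T: "tv (ev i) y \<in> carrier (SL n l)" "tv (\<lambda>a. - ev i a) y \<in> carrier (SL n l)"
    using tv_row_in_SL[of i y 1] tv_row_in_SL[of i y "-1"] i by (simp_all add: y_def)
  have "tv (ev i) y \<odot> tv (\<lambda>a. v i * e * ev r a) (ev i) \<odot> inv_SL (tv (ev i) y) =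
      tv (\<lambda>a. v i * e * ev r a) (\<lambda>b. ev i b - y b)"
    using T i r by (subst conj_tv) (auto simp: y_def)
  also have "\<dots> = tv (ev r) (\<lambda>b. e * v b)"
  proof (rule tv_cong)
    fix a b assume "b < n"
    then have "[v i * e * (ev i b - y b) = e * v b] (mod l)"
      using z[of b] r(2) i(2) by (auto simp: y_def algebra_simps intro: cong_sym)
    from cong_mult[OF cong_refl this, of "ev r a"]
    show "[v i * e * ev r a * (ev i b - y b) = ev r a * (e * v b)] (mod l)"
      by (simp only: mult_ac)
  qed
  finally show ?thesis using words_conj[OF S T(1) W[OF r(1) i(1), of "v i"]] i by simp
qed

lemma tv_add_right:
  assumes "[dot \<phi> u = 0] (mod l)"
  shows "tv u \<phi> \<odot> tv u \<psi> = tv u (\<lambda>j. \<phi> j + \<psi> j)"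
proof -
  have "[x + u i * y + u i * (z + dot \<phi> u * y) = x + u i * (z + y)] (mod l)" for i x y z
  proof -
    have "[x + u i * (z + y) + u i * y * dot \<phi> u = x + u i * (z + y) + u i * y * 0] (mod l)"
      using assms by (intro cong_add cong_mult) auto
    then show ?thesis by (simp add: algebra_simps)
  qed
  then show ?thesis
    unfolding tv_def[of u \<psi>] tv_mult_el unfolding tv_def by (intro el_eqI) simp
qed

text \<open>All factors share the row \<open>ev r\<close>, which kills \<open>v\<close>, so their
  columns add while their lengths add to \<open>m * card P\<close>.\<close>

lemma sum_col_transvection:
  assumes S: "S \<subseteq> carrier (SL n l)" and "finite P"
    and "\<And>p. p \<in> P \<Longrightarrow> tv (\<lambda>a. E p * v a) (ev r) \<in> words (SL n l) S m" "r < n" "v r = 0"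
  shows "tv (\<lambda>a. (\<Sum>p\<in>P. E p) * v a) (ev r) \<in> words (SL n l) S (m * card P)"
  using assms(2,3)
proof (induction P rule: finite_induct)
  case (insert p P)
  have "tv (\<lambda>a. E p * v a) (ev r) \<odot> tv (\<lambda>a. (\<Sum>p\<in>P. E p) * v a) (ev r) =
      tv (\<lambda>a. (\<Sum>p\<in>insert p P. E p) * v a) (ev r)"
    using assms(4,5) insert.hyps by (subst tv_add_left) (simp_all add: distrib_right)
  then show ?case
    using words_mult[OF S insert.prems[OF insertI1] insert.IH] insert by simp
qed (simp add: tv_zero)

lemma sum_row_transvection:
  assumes S: "S \<subseteq> carrier (SL n l)" and "finite P"
    and "\<And>p. p \<in> P \<Longrightarrow> tv (ev r) (\<lambda>a. E p * v a) \<in> words (SL n l) S m" "r < n" "v r = 0"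
  shows "tv (ev r) (\<lambda>a. (\<Sum>p\<in>P. E p) * v a) \<in> words (SL n l) S (m * card P)"
  using assms(2,3)
proof (induction P rule: finite_induct)
  case empty
  have "tv (ev r) (\<lambda>a. 0) = tv (\<lambda>a. 0) (\<lambda>a. 0)" by (rule tv_cong) simp
  then show ?case by (simp add: tv_zero)
next
  case (insert p P)
  have "tv (ev r) (\<lambda>a. E p * v a) \<odot> tv (ev r) (\<lambda>a. (\<Sum>p\<in>P. E p) * v a) =
      tv (ev r) (\<lambda>a. (\<Sum>p\<in>insert p P. E p) * v a)"
    using assms(4,5) insert.hyps by (subst tv_add_right) (simp_all add: distrib_right)
  then show ?case
    using words_mult[OF S insert.prems[OF insertI1] insert.IH] insert by simp
qed

text \<open>The idempotents sum to 1, so \<open>v\<close> splits into its local parts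
  \<open>E p * v\<close>. Each part uses its own \<open>A\<close>, so no single element of
  \<open>S\<close> has to be nonscalar at every prime.\<close>

lemma transvections_in_words:
  assumes S: "S \<subseteq> carrier (SL n l)"
    and ns: "\<And>p. p \<in> prime_factors l \<Longrightarrow> \<exists>A\<in>S. \<not> scalar_mat n p (reduce_mat p A)"
    and r: "r < n" "v r = 0"
  shows "tv v (ev r) \<in> words (SL n l) S (4 * card (prime_factors l))"
    "tv (ev r) v \<in> words (SL n l) S (4 * card (prime_factors l))"
proof -
  let ?P = "prime_factors l"
  obtain E where sum: "[(\<Sum>p\<in>?P. E p) = 1] (mod l)"
    and E: "\<And>p c. p \<in> ?P \<Longrightarrow> \<not> p dvd c \<Longrightarrow> \<exists>c'. [E p * (c * c') = E p] (mod l)"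
    using local_idempotents[of l] l2 by auto
  have elem: "tv (\<lambda>a. s * E p * ev i a) (ev k) \<in> words (SL n l) S 4"
    if P: "p \<in> ?P" and ik: "i < n" "k < n" "i \<noteq> k" for p i k s
  proof -
    have p: "prime p" "p dvd l" using P by auto
    obtain A where A: "A \<in> S" "\<not> scalar_mat n p (reduce_mat p A)" using ns P by blast
    obtain i' k' where "i' < n" "k' < n" "i' \<noteq> k'"
      "\<And>s. tv (\<lambda>a. s * E p * ev i' a) (ev k') \<in> words (SL n l) S 4"
      using local_elementary[OF S A(1) p A(2) E[OF P]] by blast
    then show ?thesis using elementary_move[OF S, of i' k' i k] ik by blast
  qed
  have prime: "prime p" if "p \<in> ?P" for p using that by auto
  have one: "[(\<Sum>p\<in>?P. E p) * v a = v a] (mod l)" for a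
    using cong_mult[OF sum cong_refl] by simp
  have "tv (\<lambda>a. (\<Sum>p\<in>?P. E p) * v a) (ev r) = tv v (ev r)"
    by (intro tv_cong cong_mult one cong_refl)
  moreover have "tv (\<lambda>a. (\<Sum>p\<in>?P. E p) * v a) (ev r) \<in> words (SL n l) S (4 * card ?P)"
    using local_col_transvection[where r = r and v = v, OF S prime E elem] r
    by (intro sum_col_transvection[OF S]) auto
  ultimately show "tv v (ev r) \<in> words (SL n l) S (4 * card ?P)" by simp
  have "tv (ev r) (\<lambda>a. (\<Sum>p\<in>?P. E p) * v a) = tv (ev r) v"
    by (intro tv_cong cong_mult one cong_refl)
  moreover have "tv (ev r) (\<lambda>a. (\<Sum>p\<in>?P. E p) * v a) \<in> words (SL n l) S (4 * card ?P)"
    using local_row_transvection[where r = r and v = v, OF S prime E elem] r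
    by (intro sum_row_transvection[OF S]) auto
  ultimately show "tv (ev r) v \<in> words (SL n l) S (4 * card ?P)" by simp
qed

section \<open>Reduction to transvections\<close>

lemma mult_index:
  assumes "g \<in> carrier (SL n l)" "h \<in> carrier (SL n l)" "i < n" "j < n"
  shows "(g \<odot> h) $$ (i, j) = (\<Sum>k<n. g $$ (i, k) * h $$ (k, j)) mod l"
  using mult_el[of "\<lambda>i j. g $$ (i, j)" "\<lambda>i j. h $$ (i, j)"] assms
  by (simp add: el_entries)

lemma tv_mult_index:
  assumes "g \<in> carrier (SL n l)" "i < n" "j < n"
  shows "(tv u \<phi> \<odot> g) $$ (i, j) = (g $$ (i, j) + u i * dot \<phi> (\<lambda>k. g $$ (k, j))) mod l"
  using tv_mult_el[of u \<phi> "\<lambda>i j. g $$ (i, j)"] assms by (simp add: el_entries)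

lemma mult_tv_index:
  assumes "g \<in> carrier (SL n l)" "i < n" "j < n"
  shows "(g \<odot> tv u \<phi>) $$ (i, j) = (g $$ (i, j) + dot (\<lambda>k. g $$ (i, k)) u * \<phi> j) mod l"
  using el_mult_tv[of "\<lambda>i j. g $$ (i, j)" u \<phi>] assms by (simp add: el_entries)

lemma entry_mod:
  assumes "g \<in> carrier (SL n l)" "i < n" "j < n"
  shows "g $$ (i, j) mod l = g $$ (i, j)"
  using el_index[OF assms(2,3), of "\<lambda>i j. g $$ (i, j)"] by (simp only: el_entries[OF assms(1)])

lemma of_bool_mod_l [simp]: "of_bool b mod l = of_bool b"
  using l2 by simp

text \<open>Block diagonal form with an identity block of size \<open>r\<close> in the upper left
  corner: the progress made by the elimination.\<close>

definition fixed :: "nat \<Rightarrow> int mat \<Rightarrow> bool" where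
  "fixed r g \<longleftrightarrow> (\<forall>i<n. \<forall>j<n. i < r \<or> j < r \<longrightarrow> g $$ (i, j) = of_bool (i = j))"

lemma fixedD:
  "fixed r g \<Longrightarrow> i < n \<Longrightarrow> j < n \<Longrightarrow> i < r \<or> j < r \<Longrightarrow> g $$ (i, j) = of_bool (i = j)"
  unfolding fixed_def by blast

lemma fixed_tv_mult:
  assumes "g \<in> carrier (SL n l)" "fixed r g"
    and u: "\<And>i. i < r \<Longrightarrow> u i = 0" and \<phi>: "\<And>i. i < r \<Longrightarrow> \<phi> i = 0"
  shows "fixed r (tv u \<phi> \<odot> g)"
  unfolding fixed_def
proof (intro allI impI)
  fix i j assume ij: "i < n" "j < n" "i < r \<or> j < r"
  have "dot \<phi> (\<lambda>k. g $$ (k, j)) = 0" if "j < r"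
  proof -
    have "dot \<phi> (\<lambda>k. g $$ (k, j)) = dot \<phi> (ev j)"
      unfolding dot_def using assms(2) ij that by (intro sum.cong) (auto simp: fixed_def)
    then show ?thesis using \<phi>[OF that] ij by simp
  qed
  then have 0: "u i * dot \<phi> (\<lambda>k. g $$ (k, j)) = 0" using ij(3) u by auto
  show "(tv u \<phi> \<odot> g) $$ (i, j) = of_bool (i = j)"
    unfolding tv_mult_index[OF assms(1) ij(1,2)] 0 fixedD[OF assms(2) ij] by simp
qed

lemma fixed_mult_tv:
  assumes "g \<in> carrier (SL n l)" "fixed r g"
    and u: "\<And>i. i < r \<Longrightarrow> u i = 0" and \<phi>: "\<And>i. i < r \<Longrightarrow> \<phi> i = 0"
  shows "fixed r (g \<odot> tv u \<phi>)"
  unfolding fixed_def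
proof (intro allI impI)
  fix i j assume ij: "i < n" "j < n" "i < r \<or> j < r"
  have "dot (\<lambda>k. g $$ (i, k)) u = 0" if "i < r"
  proof -
    have "dot (\<lambda>k. g $$ (i, k)) u = dot (ev i) u"
      unfolding dot_def using assms(2) ij that by (intro sum.cong) (auto simp: fixed_def)
    then show ?thesis using u[OF that] ij by simp
  qed
  then have 0: "dot (\<lambda>k. g $$ (i, k)) u * \<phi> j = 0" using ij(3) \<phi> by auto
  show "(g \<odot> tv u \<phi>) $$ (i, j) = of_bool (i = j)"
    unfolding mult_tv_index[OF assms(1) ij(1,2)] 0 fixedD[OF assms(2) ij] by simp
qed

text \<open>Such a matrix is diagonal with at most one unknown entry, and the determinant makes that
  entry 1. Hence \<open>n - 1\<close> rounds suffice.\<close>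

lemma fixed_last:
  assumes g: "g \<in> carrier (SL n l)" "fixed (n - 1) g"
  shows "g = \<one>\<^bsub>SL n l\<^esub>"
proof -
  have carr: "g \<in> carrier_mat n n" and det: "[det g = 1] (mod l)" using g(1) by (auto simp: SL_def)
  have off: "g $$ (i, j) = of_bool (i = j)" if "i < n" "j < n" "i < n - 1 \<or> j < n - 1" for i j
    using g(2) that by (rule fixedD)
  have "upper_triangular g"
  proof (rule upper_triangularI)
    fix i j assume "j < i" "i < dim_row g"
    moreover from this have "j < n - 1" using carr by auto
    ultimately show "g $$ (i, j) = 0" using off[of i j] carr by auto
  qed
  then have "det g = (\<Prod>i = 0..<n. g $$ (i, i))"
    using det_upper_triangular[OF _ carr] carr by (simp add: prod_list_diag_prod)
  also have "\<dots> = g $$ (n - 1, n - 1) * (\<Prod>i\<in>{0..<n} - {n - 1}. g $$ (i, i))"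
    using n3 by (intro prod.remove) auto
  also have "(\<Prod>i\<in>{0..<n} - {n - 1}. g $$ (i, i)) = 1"
  proof (intro prod.neutral ballI)
    fix i assume "i \<in> {0..<n} - {n - 1}"
    then have "i < n" "i < n - 1" by auto
    then show "g $$ (i, i) = 1" using off[of i i] by simp
  qed
  finally have "g $$ (n - 1, n - 1) mod l = 1" using det l2 by (simp add: cong_def)
  then have last: "g $$ (n - 1, n - 1) = 1" using entry_mod[OF g(1)] n3 by simp
  have "g $$ (i, j) = of_bool (i = j)" if "i < n" "j < n" for i j
  proof (cases "i = n - 1 \<and> j = n - 1")
    case False
    then have "i < n - 1 \<or> j < n - 1" using that by linarith
    then show ?thesis by (rule off[OF that])
  qed (use last in simp)
  then have "el (\<lambda>i j. g $$ (i, j)) = el (\<lambda>i j. of_bool (i = j))" by (intro el_eqI) simp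
  then show ?thesis by (simp only: el_entries[OF g(1)] one_el)
qed

text \<open>This is where stable range one of \<open>\<int>/l\<close> enters.\<close>

lemma exists_row_making_unit:
  assumes g: "g \<in> carrier (SL n l)" "fixed r g" and r: "Suc r < n"
  obtains w where "w (Suc r) = 0" "\<And>j. j < r \<Longrightarrow> w j = 0"
    "coprime (g $$ (Suc r, r) + dot w (\<lambda>k. g $$ (k, r))) l"
proof -
  \<comment> \<open>Row \<open>r\<close> of the inverse gives a Bezout relation for column
    \<open>r\<close> of \<open>g\<close>. Entries above \<open>r\<close> are already zero, and the
    coefficient at \<open>Suc r\<close> is split off because that row receives the unit.\<close>
  define c where "c = (\<lambda>k. inv_SL g $$ (r, k))"
  define w where "w = (\<lambda>k. if k < r \<or> k = Suc r then 0 else c k)"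
  let ?x = "\<lambda>k. g $$ (k, r)"
  have "dot c ?x = dot (\<lambda>k. c (Suc r) * ev (Suc r) k + w k) ?x"
    unfolding dot_def
  proof (intro sum.cong refl)
    fix k assume "k \<in> {..<n}"
    then have "?x k = 0" if "k < r" using g(2) r that by (simp add: fixed_def)
    then show "c k * ?x k = (c (Suc r) * ev (Suc r) k + w k) * ?x k"
      by (auto simp: w_def)
  qed
  also have "\<dots> = c (Suc r) * ?x (Suc r) + dot w ?x"
    using r by simp
  finally have bez: "[c (Suc r) * ?x (Suc r) + dot w ?x = 1] (mod l)"
    using inv_entries(2)[OF g(1), of r r] r by (simp add: dot_def c_def)
  have l0: "l \<noteq> 0" using l2 by simp
  obtain t where "coprime (?x (Suc r) + t * dot w ?x) l"
    using exists_coprime_add_mult[OF l0 bez] by blast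
  with that[of "\<lambda>k. t * w k"] show thesis by (simp add: w_def)
qed

lemma words_strip_left:
  assumes S: "S \<subseteq> carrier (SL n l)" and "t \<in> words (SL n l) S a" "x \<in> carrier (SL n l)"
    and "t \<odot> x \<in> words (SL n l) S b"
  shows "x \<in> words (SL n l) S (b + a)"
proof -
  have t: "t \<in> carrier (SL n l)" using assms(2) words_closed[OF S] by blast
  have "inv_SL t \<odot> (t \<odot> x) \<in> words (SL n l) S (a + b)"
    using words_mult[OF S words_inv[OF S assms(2)] assms(4)] .
  then show ?thesis using t assms(3) by (simp add: m_assoc[symmetric] add.commute)
qed

lemma words_strip_right:
  assumes S: "S \<subseteq> carrier (SL n l)" and "t \<in> words (SL n l) S a" "x \<in> carrier (SL n l)"
    and "x \<odot> t \<in> words (SL n l) S b"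
  shows "x \<in> words (SL n l) S (b + a)"
proof -
  have t: "t \<in> carrier (SL n l)" using assms(2) words_closed[OF S] by blast
  have "(x \<odot> t) \<odot> inv_SL t \<in> words (SL n l) S (b + a)"
    using words_mult[OF S assms(4) words_inv[OF S assms(2)]] .
  then show ?thesis using t assms(3) by (simp add: m_assoc)
qed

lemma words_unconj:
  assumes S: "S \<subseteq> carrier (SL n l)" and h: "h \<in> carrier (SL n l)" "x \<in> carrier (SL n l)"
    and "h \<odot> x \<odot> inv_SL h \<in> words (SL n l) S m"
  shows "x \<in> words (SL n l) S m"
proof -
  have "inv_SL h \<odot> (h \<odot> x \<odot> inv_SL h) \<odot> inv_SL (inv_SL h) = x"
    using h by (simp add: m_assoc) (simp add: m_assoc[symmetric])
  with words_conj[OF S inv_closed[OF h(1)] assms(4)] show ?thesis by simp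
qed

text \<open>Clearing one row and one column costs three transvections, because the conjugation
  that makes the diagonal entry \<open>1\<close> is free.\<close>

lemma fixed_in_words:
  assumes S: "S \<subseteq> carrier (SL n l)"
    and col: "\<And>r v. r < n \<Longrightarrow> v r = 0 \<Longrightarrow> tv v (ev r) \<in> words (SL n l) S m"
    and row: "\<And>r v. r < n \<Longrightarrow> v r = 0 \<Longrightarrow> tv (ev r) v \<in> words (SL n l) S m"
    and "g \<in> carrier (SL n l)" "fixed (n - 1 - d) g" "d \<le> n - 1"
  shows "g \<in> words (SL n l) S (3 * d * m)"
  using assms(4-)
proof (induction d arbitrary: g)
  case 0
  then show ?case using fixed_last[of g] by simp
next
  case (Suc d)
  \<comment> \<open>\<open>d\<close> counts the rounds still to come, so the present round clears
    index \<open>r\<close> and \<open>Suc r\<close> is still a valid row.\<close>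
  define r where "r = n - 1 - Suc d"
  have r: "r < n" "Suc r < n" and d: "n - 1 - d = Suc r" using Suc.prems(3) by (auto simp: r_def)
  note g = Suc.prems(1) and fg = Suc.prems(2)[folded r_def]
  let ?G = "SL n l"
  obtain w where w: "w (Suc r) = 0" "\<And>j. j < r \<Longrightarrow> w j = 0"
    "coprime (g $$ (Suc r, r) + dot w (\<lambda>k. g $$ (k, r))) l"
    using exists_row_making_unit[OF g fg r(2)] by blast
  define t1 where "t1 = tv (ev (Suc r)) w"
  have t1: "t1 \<in> words ?G S m" "t1 \<in> carrier ?G"
    using row[of "Suc r" w] r(2) w(1) words_closed[OF S] unfolding t1_def by blast+
  define g1 where "g1 = t1 \<odot> g"
  have g1: "g1 \<in> carrier ?G" "fixed r g1"
    using g fg t1 w(2) fixed_tv_mult[OF g fg, of "ev (Suc r)" w] by (auto simp: g1_def t1_def)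
  define a where "a = g1 $$ (Suc r, r)"
  have "coprime a l"
    using w(3) r l2 by (simp add: a_def g1_def t1_def tv_mult_index[OF g] coprime_mod_left_iff)
  then obtain y' where y': "[a * y' = 1] (mod l)" using cong_solve_coprime_int by blast
  \<comment> \<open>Adding \<open>y\<close> times row \<open>Suc r\<close> to row \<open>r\<close>
    makes the diagonal entry 1, as \<open>y'\<close> inverts \<open>a\<close>.\<close>
  define y where "y = (1 - g1 $$ (r, r)) * y'"
  have y: "(g1 $$ (r, r) + y * a) mod l = 1"
  proof -
    have "[g1 $$ (r, r) + (1 - g1 $$ (r, r)) * (a * y') = g1 $$ (r, r) + (1 - g1 $$ (r, r)) * 1] (mod l)"
      using y' by (intro cong_add cong_mult) auto
    then show ?thesis using l2 by (simp add: y_def cong_def mult_ac)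
  qed
  define h where "h = tv (\<lambda>i. y * ev r i) (ev (Suc r))"
  have h: "h \<in> carrier ?G" "tv (\<lambda>i. - (y * ev r i)) (ev (Suc r)) \<in> carrier ?G"
    unfolding h_def using r by (auto intro!: tv_col_in_SL)
  have invh: "inv_SL h = tv (\<lambda>i. - (y * ev r i)) (ev (Suc r))"
    using h r unfolding h_def by (intro inv_tv) auto
  define g1' where "g1' = h \<odot> g1"
  have g1': "g1' \<in> carrier ?G" "fixed r g1'"
    using h g1 fixed_tv_mult[OF g1, of "\<lambda>i. y * ev r i" "ev (Suc r)"] by (auto simp: g1'_def h_def)
  \<comment> \<open>Completing the conjugation alters only column \<open>Suc r\<close>, so the new
    diagonal entry at \<open>r\<close> survives.\<close>
  define g2 where "g2 = g1' \<odot> inv_SL h"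
  have g2: "g2 \<in> carrier ?G" "fixed r g2"
    using h g1' fixed_mult_tv[OF g1', of "\<lambda>i. - (y * ev r i)" "ev (Suc r)"]
    by (auto simp: g2_def invh)
  have "g1' $$ (r, r) = 1"
    unfolding g1'_def h_def using r y by (simp add: tv_mult_index[OF g1(1)] a_def)
  then have g2rr: "g2 $$ (r, r) = 1"
    unfolding g2_def invh using r l2 by (simp add: mult_tv_index[OF g1'(1)])
  define v where "v = (\<lambda>i. if i = r then 0 else - g2 $$ (i, r))"
  define t2 where "t2 = tv v (ev r)"
  have t2: "t2 \<in> words ?G S m" "t2 \<in> carrier ?G"
    using col[of r v] r words_closed[OF S] unfolding t2_def v_def by auto
  define g3 where "g3 = t2 \<odot> g2"
  have v0: "v i = 0" if "i < r" for i using g2(2) that r by (simp add: fixed_def v_def)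
  have g3: "g3 \<in> carrier ?G" "fixed r g3"
    using t2 g2 fixed_tv_mult[OF g2, of v "ev r"] v0 by (auto simp: g3_def t2_def)
  have g3r: "g3 $$ (i, r) = of_bool (i = r)" if "i < n" for i
    unfolding g3_def t2_def using that r g2rr l2 by (simp add: tv_mult_index[OF g2(1)] v_def)
  define w' where "w' = (\<lambda>j. if j = r then 0 else - g3 $$ (r, j))"
  define t3 where "t3 = tv (ev r) w'"
  have t3: "t3 \<in> words ?G S m" "t3 \<in> carrier ?G"
    using row[of r w'] r words_closed[OF S] unfolding t3_def w'_def by auto
  \<comment> \<open>Column \<open>r\<close> of \<open>g3\<close> is already
    \<open>e\<^sub>r\<close>, so this product changes only row \<open>r\<close>.\<close>
  define g4 where "g4 = g3 \<odot> t3"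
  have w0: "w' i = 0" if "i < r" for i using g3(2) that r by (simp add: fixed_def w'_def)
  have g4: "g4 \<in> carrier ?G" "fixed r g4"
    using t3 g3 fixed_mult_tv[OF g3, of "ev r" w'] w0 by (auto simp: g4_def t3_def)
  have g4_col: "g4 $$ (i, r) = of_bool (i = r)" if "i < n" for i
    unfolding g4_def t3_def using that r g3r[OF that] by (simp add: mult_tv_index[OF g3(1)] w'_def)
  have g4_row: "g4 $$ (r, j) = of_bool (r = j)" if "j < n" "j \<noteq> r" for j
    unfolding g4_def t3_def using that r g3r[OF r(1)] by (simp add: mult_tv_index[OF g3(1)] w'_def)
  have "fixed (Suc r) g4"
    unfolding fixed_def
  proof (intro allI impI)
    fix i j assume ij: "i < n" "j < n" "i < Suc r \<or> j < Suc r"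
    then consider "i < r \<or> j < r" | "j = r" | "i = r" "j \<noteq> r" by linarith
    then show "g4 $$ (i, j) = of_bool (i = j)"
      using g4(2) g4_col g4_row ij by cases (auto simp: fixed_def)
  qed
  then have "g4 \<in> words ?G S (3 * d * m)"
    using Suc.IH[of g4] g4(1) d Suc.prems(3) by simp
  \<comment> \<open>The operations are undone in reverse order: three transvections cost
    \<open>m\<close> each, the conjugation by \<open>h\<close> nothing.\<close>
  then have "g3 \<in> words ?G S (3 * d * m + m)"
    unfolding g4_def by (rule words_strip_right[OF S t3(1) g3(1)])
  then have "g2 \<in> words ?G S (3 * d * m + m + m)"
    unfolding g3_def by (rule words_strip_left[OF S t2(1) g2(1)])
  then have "g1 \<in> words ?G S (3 * d * m + m + m)"
    unfolding g2_def g1'_def by (rule words_unconj[OF S h(1) g1(1)])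
  then have "g \<in> words ?G S (3 * d * m + m + m + m)"
    unfolding g1_def by (rule words_strip_left[OF S t1(1) g])
  also have "3 * d * m + m + m + m = 3 * Suc d * m" by (simp add: algebra_simps)
  finally show ?case .
qed

text \<open>\<open>fixed 0\<close> holds vacuously, so the elimination starts at
  \<open>d = n - 1\<close> for every \<open>g\<close>.\<close>

lemma SL_subset_words:
  assumes S: "S \<subseteq> carrier (SL n l)"
    and ns: "\<And>p. p \<in> prime_factors l \<Longrightarrow> \<exists>A\<in>S. \<not> scalar_mat n p (reduce_mat p A)"
  shows "carrier (SL n l) \<subseteq> words (SL n l) S (12 * card (prime_factors l) * (n - 1))"
proof
  fix g assume g: "g \<in> carrier (SL n l)"
  have "g \<in> words (SL n l) S (3 * (n - 1) * (4 * card (prime_factors l)))"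
    using transvections_in_words[OF S ns] g
    by (intro fixed_in_words[OF S]) (auto simp: fixed_def)
  then show "g \<in> words (SL n l) S (12 * card (prime_factors l) * (n - 1))"
    by (simp add: mult_ac)
qed


section \<open>Matrices that are scalar modulo a prime\<close>

text \<open>The preimage of the scalar matrices under reduction modulo \<open>p\<close>, normal
  because scalars commute with everything. It is the obstruction to normal generation at
  \<open>p\<close>.\<close>

lemma scalar_mod_normal:
  fixes p :: int
  assumes p: "p dvd l"
  shows "{A \<in> carrier (SL n l). \<exists>c. \<forall>i<n. \<forall>j<n. [A $$ (i, j) = c * of_bool (i = j)] (mod p)} \<lhd> SL n l"
    (is "?N \<lhd> _")
proof -
  have mult: "[(A \<odot> B) $$ (i, j) = (\<Sum>k<n. A $$ (i, k) * B $$ (k, j))] (mod p)"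
    if "A \<in> carrier (SL n l)" "B \<in> carrier (SL n l)" "i < n" "j < n" for A B i j
    using mult_index[OF that] by (intro cong_dvd_modulus[OF _ p]) (simp add: cong_def)
  have scal: "[(A \<odot> B) $$ (i, j) = c * B $$ (i, j)] (mod p)"
    if A: "\<forall>i<n. \<forall>j<n. [A $$ (i, j) = c * of_bool (i = j)] (mod p)"
      and G: "A \<in> carrier (SL n l)" "B \<in> carrier (SL n l)" and ij: "i < n" "j < n" for A B c i j
  proof -
    have "[(\<Sum>k<n. A $$ (i, k) * B $$ (k, j)) = (\<Sum>k<n. of_bool (i = k) * (c * B $$ (k, j)))] (mod p)"
    proof (rule cong_sum)
      fix k assume "k \<in> {..<n}"
      then have "[A $$ (i, k) * B $$ (k, j) = (c * of_bool (i = k)) * B $$ (k, j)] (mod p)"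
        using A ij by (intro cong_mult) auto
      then show "[A $$ (i, k) * B $$ (k, j) = of_bool (i = k) * (c * B $$ (k, j))] (mod p)"
        by (simp only: mult_ac)
    qed
    then show ?thesis
      using mult[OF G ij] unfolding sum_of_bool_mult(1)[OF ij(1)] by (blast intro: cong_trans)
  qed
  have one_index: "\<one>\<^bsub>SL n l\<^esub> $$ (i, j) = of_bool (i = j)" if "i < n" "j < n" for i j
    using that by (simp add: one_el)
  have "subgroup ?N (SL n l)"
  proof (rule subgroupI)
    have "\<one>\<^bsub>SL n l\<^esub> \<in> ?N" using one_index by (auto intro!: exI[of _ 1])
    then show "?N \<noteq> {}" by blast
  next
    fix A assume "A \<in> ?N"
    then obtain c where A: "A \<in> carrier (SL n l)"
      and c: "\<forall>i<n. \<forall>j<n. [A $$ (i, j) = c * of_bool (i = j)] (mod p)" by blast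
    let ?B = "\<lambda>i j. inv_SL A $$ (i, j)"
    have cB: "[c * ?B i j = of_bool (i = j)] (mod p)" if "i < n" "j < n" for i j
      using scal[OF c A inv_closed[OF A] that] A one_index[OF that] by (simp add: cong_sym_eq)
    \<comment> \<open>Entry \<open>(0, 0)\<close> of the inverse is an inverse of \<open>c\<close>
      modulo \<open>p\<close>, hence the scalar for the inverse matrix.\<close>
    have "[?B i j = ?B 0 0 * of_bool (i = j)] (mod p)" if "i < n" "j < n" for i j
    proof -
      have "[(c * ?B 0 0) * ?B i j = of_bool (0 = (0::nat)) * ?B i j] (mod p)"
        using n3 by (intro cong_mult cB) auto
      then have "[?B i j = ?B 0 0 * (c * ?B i j)] (mod p)"
        by (simp add: cong_sym_eq mult_ac)
      also have "[?B 0 0 * (c * ?B i j) = ?B 0 0 * of_bool (i = j)] (mod p)"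
        by (intro cong_mult cB[OF that]) auto
      finally show ?thesis .
    qed
    then show "inv_SL A \<in> ?N" using A by blast
  next
    fix A B assume "A \<in> ?N" "B \<in> ?N"
    then obtain c d where A: "A \<in> carrier (SL n l)" and B: "B \<in> carrier (SL n l)"
      and c: "\<forall>i<n. \<forall>j<n. [A $$ (i, j) = c * of_bool (i = j)] (mod p)"
      and d: "\<forall>i<n. \<forall>j<n. [B $$ (i, j) = d * of_bool (i = j)] (mod p)" by blast
    have "[(A \<odot> B) $$ (i, j) = (c * d) * of_bool (i = j)] (mod p)" if "i < n" "j < n" for i j
      using cong_trans[OF scal[OF c A B that] cong_mult[OF cong_refl]] d that
      by (simp only: mult.assoc)
    then show "A \<odot> B \<in> ?N" using A B by blast
  qed auto
  moreover have "x \<odot> A \<odot> inv_SL x \<in> ?N" if x: "x \<in> carrier (SL n l)" and "A \<in> ?N" for x A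
  proof -
    obtain c where A: "A \<in> carrier (SL n l)"
      and c: "\<forall>i<n. \<forall>j<n. [A $$ (i, j) = c * of_bool (i = j)] (mod p)"
      using \<open>A \<in> ?N\<close> by blast
    have "[(x \<odot> (A \<odot> inv_SL x)) $$ (i, j) = c * of_bool (i = j)] (mod p)" if ij: "i < n" "j < n" for i j
    proof -
      have "[(x \<odot> (A \<odot> inv_SL x)) $$ (i, j) =
          (\<Sum>k<n. x $$ (i, k) * (A \<odot> inv_SL x) $$ (k, j))] (mod p)"
        using x A ij by (intro mult) auto
      also have "[(\<Sum>k<n. x $$ (i, k) * (A \<odot> inv_SL x) $$ (k, j)) =
          (\<Sum>k<n. x $$ (i, k) * (c * inv_SL x $$ (k, j)))] (mod p)"
        using x A ij by (intro cong_sum cong_mult scal[OF c]) auto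
      also have "(\<Sum>k<n. x $$ (i, k) * (c * inv_SL x $$ (k, j))) =
          c * (\<Sum>k<n. x $$ (i, k) * inv_SL x $$ (k, j))"
        by (simp add: sum_distrib_left mult_ac)
      also have "[\<dots> = c * of_bool (i = j)] (mod p)"
        by (intro cong_mult cong_refl cong_dvd_modulus[OF inv_entries(1)[OF x ij] p])
      finally show ?thesis .
    qed
    then have "x \<odot> (A \<odot> inv_SL x) \<in> ?N" using x A by blast
    then show ?thesis using x A by (simp only: m_assoc inv_closed)
  qed
  ultimately show ?thesis unfolding normal_inv_iff by blast
qed

text \<open>Otherwise \<open>S\<close> lies in the normal subgroup of matrices scalar modulo
  \<open>p\<close>, which misses the elementary matrix \<open>tv (ev 0) (ev 1)\<close>.\<close>

lemma normally_generates_nonscalar: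
  assumes S: "normally_generates (SL n l) S" and p: "p \<in> prime_factors l"
  shows "\<exists>A\<in>S. \<not> scalar_mat n p (reduce_mat p A)"
proof (rule ccontr)
  assume neg: "\<not> ?thesis"
  have pr: "prime p" "p dvd l" using p by auto
  let ?N = "{A \<in> carrier (SL n l). \<exists>c. \<forall>i<n. \<forall>j<n. [A $$ (i, j) = c * of_bool (i = j)] (mod p)}"
  have "S \<subseteq> ?N"
  proof
    fix A assume A: "A \<in> S"
    then have AG: "A \<in> carrier (SL n l)" using S by (auto simp: normally_generates_def)
    then have carr: "A \<in> carrier_mat n n" by (auto simp: SL_def)
    obtain c where c: "reduce_mat p A = c \<cdot>\<^sub>m 1\<^sub>m n" using neg A by (auto simp: scalar_mat_def)
    have "[A $$ (i, j) = c * of_bool (i = j)] (mod p)" if "i < n" "j < n" for i j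
    proof -
      have "A $$ (i, j) mod p = c * of_bool (i = j)"
        using arg_cong[OF c, of "\<lambda>M. M $$ (i, j)"] that carr by (auto simp: reduce_mat_def)
      then show ?thesis by (metis cong_def mod_mod_trivial)
    qed
    with AG show "A \<in> ?N" by blast
  qed
  then have "normal_closure (SL n l) S \<subseteq> ?N"
    unfolding normal_closure_def using scalar_mod_normal[OF pr(2)] by blast
  moreover have E: "tv (ev 0) (ev 1) \<in> carrier (SL n l)"
    using n3 by (intro tv_col_in_SL) auto
  ultimately obtain c where "\<forall>i<n. \<forall>j<n. [tv (ev 0) (ev 1) $$ (i, j) = c * of_bool (i = j)] (mod p)"
    using S unfolding normally_generates_def by blast
  from this[rule_format, of 0 1] have "[1 = 0] (mod p)"
    using n3 l2 by (simp add: tv_def)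
  then have "is_unit p" by (simp only: cong_0_iff)
  with pr(1) show False using not_prime_unit by blast
qed

end

section \<open>The bounds on \<open>Delta\<close> and on the size of a conjugacy class\<close>

theorem proposition1p8:
  fixes l :: int and n k :: nat
  assumes "l \<ge> 2" and "n \<ge> 3"
    and "k = card (prime_factors l)"
  shows "Delta (SL n l) \<le> enat (12 * k * (n - 1)) \<and>
    (\<forall>A S. A \<in> carrier (SL n l)
       \<longrightarrow> (\<forall>p\<in>prime_factors l. \<not> scalar_mat n p (reduce_mat p A))
       \<longrightarrow> S = conjugacy_class (SL n l) A
       \<longrightarrow> log 2 (real (card S))
             \<ge> log 2 (real (card (carrier (SL n l)))) / real (12 * k * (n - 1)) - 2)"
proof (intro conjI allI impI)
  interpret special_linear n l by standard (use assms in auto)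
  let ?G = "SL n l"
  show "Delta ?G \<le> enat (12 * k * (n - 1))"
    unfolding Delta_def group_norm_def
  proof (intro SUP_least)
    fix S g assume "S \<in> {S. finite S \<and> normally_generates ?G S}" and g: "g \<in> carrier ?G"
    then have S: "normally_generates ?G S" by blast
    then have "S \<subseteq> carrier ?G" by (simp add: normally_generates_def)
    then have "carrier ?G \<subseteq> words ?G S (12 * k * (n - 1))"
      unfolding assms(3) by (intro SL_subset_words normally_generates_nonscalar[OF S])
    with g show "word_norm ?G S g \<le> enat (12 * k * (n - 1))" by (intro word_norm_le) blast
  qed
  fix A S
  assume A: "A \<in> carrier ?G" and ns: "\<forall>p\<in>prime_factors l. \<not> scalar_mat n p (reduce_mat p A)"
    and S: "S = conjugacy_class ?G A"
  define N where "N = 12 * k * (n - 1)"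
  have finS: "finite S"
    using conjugacy_class_closed[OF A] finite_SL finite_subset unfolding S by blast
  \<comment> \<open>With the singleton \<open>{A}\<close> as generating set, the letters are exactly
    the elements of \<open>S\<close> and their inverses.\<close>
  have conj: "conjugates ?G {A} = S \<union> inv_SL ` S"
    unfolding S by (rule conjugates_conjugacy_class[OF A])
  have "card (conjugates ?G {A}) \<le> card S + card S"
    unfolding conj using card_Un_le[of S "inv_SL ` S"] card_image_le[OF finS, of inv_SL] by linarith
  have sub: "carrier ?G \<subseteq> words ?G {A} N"
    unfolding N_def assms(3) using A ns by (intro SL_subset_words) auto
  have fin: "finite (conjugates ?G {A})" unfolding conj using finS by simp
  have "card (carrier ?G) \<le> card (words ?G {A} N)"
    using card_words_le[OF fin, of N] sub by (intro card_mono) auto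
  also have "\<dots> \<le> card (conjugates ?G {A}) ^ N" using card_words_le[OF fin, of N] by simp
  also have "\<dots> \<le> (2 * card S) ^ N"
    using \<open>card (conjugates ?G {A}) \<le> card S + card S\<close> by (intro power_mono) auto
  finally have "real (card (carrier ?G)) \<le> (2 * real (card S)) ^ N"
    by (metis of_nat_le_iff of_nat_mult of_nat_numeral of_nat_power)
  moreover have "card (carrier ?G) > 0" using finite_SL one_closed by (auto simp: card_gt_0_iff)
  moreover have Spos: "card S > 0"
  proof -
    have "A \<in> conjugates ?G {A}" using subset_conjugates[of "{A}"] A by blast
    then have "S \<noteq> {}" unfolding conj by blast
    then show ?thesis using finS by (simp add: card_gt_0_iff)
  qed
  ultimately have "log 2 (real (card (carrier ?G))) \<le> log 2 ((2 * real (card S)) ^ N)"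
    by (subst log_le_cancel_iff) auto
  \<comment> \<open>The summand 1 is the logarithm of the factor 2 that accounts for
    inverses.\<close>
  also have "\<dots> = N * (1 + log 2 (real (card S)))"
    using Spos by (simp add: log_nat_power log_mult distrib_left)
  finally have le: "log 2 (real (card (carrier ?G))) \<le> N * (1 + log 2 (real (card S)))" .
  obtain p where "prime p" "p dvd l" using prime_divisor_exists[of l] assms(1) by auto
  then have "p \<in> prime_factors l" using assms(1) by (auto simp: prime_factors_dvd)
  then have "k > 0" unfolding assms(3) by (auto simp: card_gt_0_iff)
  then have "N > 0" using assms(2) by (simp add: N_def)
  then have "log 2 (real (card (carrier ?G))) / N \<le> 1 + log 2 (real (card S))"
    using le by (simp add: divide_le_eq mult.commute)
  \<comment> \<open>The counting gives the inequality with 1 subtracted, hence also with 2.\<close>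
  then show "log 2 (real (card S)) \<ge> log 2 (real (card (carrier ?G))) / real (12 * k * (n - 1)) - 2"
    unfolding N_def by simp
qed

end
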